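(* Let $\varepsilon>0$. In the randomized IPDS algorithm (described in the context), choose $\rho_0=8L_{\mathrm D}$ and, for every $k\in\mathbb Z_+$, $\tau_k=\frac{k+1}{k+3}$, $\gamma_k=\frac{\varepsilon}{4(k+3)}$, $\eta_k=\frac{\varepsilon}{4(k+3)}$. Then for any starting point $(x^0,\lambda^0)\in\mathcal X\times\Lambda$ and any $K\in\mathbb N$, $$\mathbb E[\Delta_{\rho_K}(x^K,\lambda^K)]\le\frac{2\Delta_{\rho_0}(x^0,\lambda^0)}{(K+1)(K+2)}+\frac\varepsilon2.$$ Moreover, if $\Lambda$ is bounded, then $$\mathbb E[\Delta(x^K,\lambda^K)]\le\frac{32L_{\mathrm D}B_{\omega,\Lambda}+2\Delta(x^0,\lambda^0)}{(K+1)(K+2)}+\frac\varepsilon2,$$ where $B_{\omega,\Lambda}:=\sup_{\lambda\in\Lambda}|\omega(\lambda)|$.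
   Context: Setting. $\mathbb E_1,\mathbb E_2$ are finite-dimensional real normed spaces (norms $\|\cdot\|$, dual norms $\|\cdot\|_*$, pairing $\langle\cdot,\cdot\rangle$). $\mathcal X\subseteq\mathbb E_1$, $\Lambda\subseteq\mathbb E_2$ are nonempty, closed, convex, $\mathcal X$ bounded. $f,g:\mathbb E_1\to\mathbb R\cup\{+\infty\}$, $h:\mathbb E_2\to\mathbb R\cup\{+\infty\}$ are convex, closed, proper, $\mathcal X\subseteq\mathrm{dom}\,g$, $\Lambda\subseteq\mathrm{dom}\,h$. $f$ is differentiable on an open set containing $\mathcal X$, and $\frac\mu2\|x-x'\|^2\le f(x)-f(x')-\langle\nabla f(x'),x-x'\rangle\le\frac L2\|x-x'\|^2$ for $x,x'\in\mathcal X$, with $L\ge\mu>0$. $\Phi:\mathbb E_1\times\mathbb E_2\to\mathbb R$ is convex in $x$, concave in $\lambda$, differentiable in each argument, and for all $x,x'\in\mathcal X$, $\lambda,\lambda'\in\Lambda$: $\|\nabla_x\Phi(x,\lambda)-\nabla_x\Phi(x',\lambda)\|_*\le L_{xx}\|x-x'\|$, $\|\nabla_x\Phi(x,\lambda)-\nabla_x\Phi(x,\lambda')\|_*\le L_{\lambda x}\|\lambda-\lambda'\|$, $\|\nabla_\lambda\Phi(x,\lambda)-\nabla_\lambda\Phi(x',\lambda)\|_*\le L_{\lambda x}\|x-x'\|$, $\|\nabla_\lambda\Phi(x,\lambda)-\nabla_\lambda\Phi(x,\lambda')\|_*\le L_{\lambda\lambda}\|\lambda-\lambda'\|$. The problem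 is $\min_{x\in\mathcal X}\max_{\lambda\in\Lambda}S(x,\lambda)$, $S(x,\lambda):=f(x)+g(x)+\Phi(x,\lambda)-h(\lambda)$; a saddle point on $\mathcal X\times\Lambda$ exists. $\omega:\mathbb E_2\to\mathbb R\cup\{+\infty\}$ is convex, closed, proper, $1$-strongly convex and continuous (finite) on $\Lambda$, and essentially smooth. $L_{\mathrm D}:=L_{\lambda\lambda}+L_{\lambda x}^2/\mu$ (the choice $\rho_0=8L_{\mathrm D}$ together with the requirement $\rho_0>0$ means $L_{\mathrm D}>0$). Definitions. $\psi^{\mathrm P}(x):=\sup_{\lambda\in\Lambda}S(x,\lambda)$, $\psi^{\mathrm D}(\lambda):=\inf_{x\in\mathcal X}S(x,\lambda)$, $\Delta(x,\lambda):=\psi^{\mathrm P}(x)-\psi^{\mathrm D}(\lambda)$. For $\rho>0$: $S_\rho(x,\lambda):=S(x,\lambda)-\rho\,\omega(\lambda)$, $\psi^{\mathrm P}_\rho(x):=\sup_{\lambda\in\Lambda}S_\rho(x,\lambda)$, and $\Delta_\rho(x,\lambda):=\psi^{\mathrm P}_\rho(x)-\psi^{\mathrm D}(\lambda)$. Randomized IPDS algorithm. Inputs: $\rho_0>0$, nonnegative sequences $\{\eta_k\},\{\gamma_k\}$, $\{\tau_k\}\subseteq(0,1)$ $(k\in\mathbb Z_+=\{0,1,\dots\})$, deterministic $x^0\in\mathcal X$, $\lambda^0\in\Lambda$. For $k=0,1,\dots$: (1) a randomized method produces $\widetilde\lambda_{\rho_k,\eta_k}(x^k)\in\Lambda$ with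 $\mathbb E[\psi^{\mathrm P}_{\rho_k}(x^k)-S_{\rho_k}(x^k,\widetilde\lambda_{\rho_k,\eta_k}(x^k))\mid\mathcal F_{k,0}]\le\eta_k$ a.s.; (2) $\hat\lambda^k=\tau_k\lambda^k+(1-\tau_k)\widetilde\lambda_{\rho_k,\eta_k}(x^k)$; (3) a randomized method produces $\widetilde x_{\gamma_k}(\hat\lambda^k)\in\mathcal X$ with $\mathbb E[S(\widetilde x_{\gamma_k}(\hat\lambda^k),\hat\lambda^k)-\psi^{\mathrm D}(\hat\lambda^k)\mid\mathcal F_{k,1}]\le\gamma_k$ a.s.; (4) $x^{k+1}=\tau_kx^k+(1-\tau_k)\widetilde x_{\gamma_k}(\hat\lambda^k)$; (5) $\rho_{k+1}=\tau_k\rho_k$; (6) a randomized method produces $\widetilde\lambda_{\rho_{k+1},\eta_k}(x^{k+1})\in\Lambda$ with $\mathbb E[\psi^{\mathrm P}_{\rho_{k+1}}(x^{k+1})-S_{\rho_{k+1}}(x^{k+1},\widetilde\lambda_{\rho_{k+1},\eta_k}(x^{k+1}))\mid\mathcal F_{k,2}]\le\eta_k$ a.s.; (7) $\lambda^{k+1}=\tau_k\lambda^k+(1-\tau_k)\widetilde\lambda_{\rho_{k+1},\eta_k}(x^{k+1})$. Filtration: $\mathcal F_{0,0}$ is trivial, $\mathcal F_{k,1}$ is generated by $\mathcal F_{k,0}$ and $\widetilde\lambda_{\rho_k,\eta_k}(x^k)$; $\mathcal F_{k,2}$ by $\mathcal F_{k,1}$ and $\widetilde x_{\gamma_k}(\hat\lambda^k)$;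 $\mathcal F_{k+1,0}$ by $\mathcal F_{k,2}$ and $\widetilde\lambda_{\rho_{k+1},\eta_k}(x^{k+1})$. *)

theory Defs
  imports "HOL-Probability.Probability"
begin

section \<open>Finite-dimensional normed spaces and convex analysis\<close>

text \<open>A finite-dimensional real vector space with an arbitrary norm (not necessarily induced by
  an inner product, which rules out \<open>euclidean_space\<close>).\<close>

class finite_dim_normed = real_normed_vector +
  assumes finite_dim: "\<exists>B. finite B \<and> (\<forall>x. \<exists>c. x = (\<Sum>b\<in>B. c b *\<^sub>R b))"

text \<open>Second countability is what the library needs in order to know that sums of Borel random
  vectors are Borel.\<close>

instance finite_dim_normed \<subseteq> second_countable_topology
proof
  obtain B :: "'a set" where B: "finite B" "\<And>x. \<exists>c. x = (\<Sum>b\<in>B. c b *\<^sub>R b)"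
    using finite_dim by metis
  define D where "D = (\<lambda>q. \<Sum>b\<in>B. real_of_rat (q b) *\<^sub>R b) ` (B \<rightarrow>\<^sub>E (UNIV :: rat set))"
  have "countable (B \<rightarrow>\<^sub>E (UNIV :: rat set))"
    using B(1) by (intro countable_PiE) auto
  then have cD: "countable D"
    unfolding D_def by (rule countable_image)
  have dense: "\<exists>d\<in>D. dist d x < e" if e: "e > 0" for x :: 'a and e :: real
  proof -
    obtain u where u: "x = (\<Sum>b\<in>B. u b *\<^sub>R b)"
      using B(2) by blast
    define c where "c = (\<Sum>b\<in>B. norm b) + 1"
    have c: "c > 0" unfolding c_def by (simp add: add_nonneg_pos sum_nonneg)
    have "\<exists>q. \<bar>real_of_rat q - u b\<bar> < e / c" for b
    proof -
      have "u b - e / c < u b + e / c" using e c by simp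
      then obtain q where "u b - e / c < real_of_rat q" "real_of_rat q < u b + e / c"
        using of_rat_dense by blast
      then show ?thesis by (intro exI[of _ q]) (auto simp: abs_less_iff)
    qed
    then obtain q where q: "\<And>b. \<bar>real_of_rat (q b) - u b\<bar> < e / c" by metis
    let ?d = "\<Sum>b\<in>B. real_of_rat (restrict q B b) *\<^sub>R b"
    have "?d \<in> D" unfolding D_def by (rule imageI) auto
    moreover have "dist ?d x < e"
    proof -
      have "?d - x = (\<Sum>b\<in>B. (real_of_rat (q b) - u b) *\<^sub>R b)"
        unfolding u by (simp add: scaleR_diff_left sum_subtractf)
      then have "norm (?d - x) \<le> (\<Sum>b\<in>B. \<bar>real_of_rat (q b) - u b\<bar> * norm b)"
        by (metis (no_types, lifting) norm_scaleR norm_sum sum.cong)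
      also have "\<dots> \<le> (\<Sum>b\<in>B. e / c * norm b)"
        by (intro sum_mono mult_right_mono less_imp_le[OF q]) auto
      also have "\<dots> = e / c * (c - 1)"
        by (simp add: c_def sum_distrib_left)
      also have "\<dots> < e" using e c by (simp add: field_simps)
      finally show ?thesis by (simp add: dist_norm)
    qed
    ultimately show ?thesis by blast
  qed
  define T where "T = (\<lambda>(d, n). ball d (1 / real (Suc n))) ` (D \<times> (UNIV :: nat set))"
  have "countable T" unfolding T_def using cD by auto
  moreover have "topological_basis T"
  proof (rule topological_basisI)
    show "open U" if "U \<in> T" for U using that unfolding T_def by auto
  next
    fix U and x :: 'a
    assume "open U" "x \<in> U"
    then obtain e where e: "e > 0" "ball x e \<subseteq> U" by (meson openE)
    obtain n where n: "1 / real (Suc n) < e / 2"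
      using e(1) nat_approx_posE[of "e / 2"] by auto
    obtain d where d: "d \<in> D" "dist d x < 1 / real (Suc n)"
      using dense[of "1 / real (Suc n)" x] by auto
    have "ball d (1 / real (Suc n)) \<subseteq> ball x e"
    proof
      fix y assume "y \<in> ball d (1 / real (Suc n))"
      then have "dist d y < 1 / real (Suc n)" by simp
      then have "dist x y < e"
        using dist_triangle[of x y d] d(2) n by (simp add: dist_commute)
      then show "y \<in> ball x e" by simp
    qed
    then show "\<exists>V\<in>T. x \<in> V \<and> V \<subseteq> U"
      using d e(2) unfolding T_def
      by (intro bexI[of _ "ball d (1 / real (Suc n))"]) auto
  qed
  ultimately show "\<exists>T::'a set set. countable T \<and> open = generate_topology T"
    using topological_basis_imp_subbasis by blast
qed

definition effdom :: "('a \<Rightarrow> ereal) \<Rightarrow> 'a set" where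
  "effdom f = {x. f x < \<infinity>}"

definition epigraph :: "('a \<Rightarrow> ereal) \<Rightarrow> ('a \<times> real) set" where
  "epigraph f = {(x, r). f x \<le> ereal r}"

definition convex_closed_proper :: "('a::real_normed_vector \<Rightarrow> ereal) \<Rightarrow> bool" where
  "convex_closed_proper f \<longleftrightarrow>
     convex (epigraph f) \<and> closed (epigraph f) \<and> effdom f \<noteq> {} \<and> (\<forall>x. f x \<noteq> - \<infinity>)"

text \<open>The gradient is the derivative as an element of the dual space: \<open>blinfun_apply\<close> is the
  pairing, and the norm of the type of bounded linear functionals is the dual norm. It is only
  used at points of differentiability.\<close>

definition grad :: "('a::real_normed_vector \<Rightarrow> real) \<Rightarrow> 'a \<Rightarrow> 'a \<Rightarrow>\<^sub>L real" where
  "grad F x = Blinfun (frechet_derivative F (at x))"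

text \<open>Real-valued version of an extended real-valued function, meaningful where the latter is
  finite.\<close>

abbreviation (input) real_val :: "('a \<Rightarrow> ereal) \<Rightarrow> 'a \<Rightarrow> real" where
  "real_val f \<equiv> (\<lambda>x. real_of_ereal (f x))"

definition ereal_differentiable_on :: "('a::real_normed_vector \<Rightarrow> ereal) \<Rightarrow> 'a set \<Rightarrow> bool" where
  "ereal_differentiable_on f U \<longleftrightarrow>
     (\<forall>x\<in>U. \<bar>f x\<bar> \<noteq> \<infinity>) \<and> (\<forall>x\<in>U. real_val f differentiable (at x))"

definition strongly_convex_on :: "real \<Rightarrow> 'a::real_normed_vector set \<Rightarrow> ('a \<Rightarrow> ereal) \<Rightarrow> bool" where
  "strongly_convex_on m C f \<longleftrightarrow>
     (\<forall>x\<in>C. \<forall>y\<in>C. \<forall>t\<in>{0..1}.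
        f ((1 - t) *\<^sub>R x + t *\<^sub>R y)
          \<le> ereal (1 - t) * f x + ereal t * f y - ereal (m / 2 * t * (1 - t) * (norm (x - y))\<^sup>2))"

text \<open>Essential smoothness in the sense of Rockafellar.\<close>

definition essentially_smooth :: "('a::real_normed_vector \<Rightarrow> ereal) \<Rightarrow> bool" where
  "essentially_smooth f \<longleftrightarrow>
     interior (effdom f) \<noteq> {} \<and>
     ereal_differentiable_on f (interior (effdom f)) \<and>
     (\<forall>u x. (\<forall>n. u n \<in> interior (effdom f)) \<and> u \<longlonglongrightarrow> x \<and> x \<in> frontier (interior (effdom f))
        \<longrightarrow> filterlim (\<lambda>n::nat. norm (grad (real_val f) (u n))) at_top sequentially)"


section \<open>The saddle point problem\<close>

text \<open>All the functions below are only evaluated on \<open>X\<close> and \<open>\<Lambda>\<close>, where \<open>f\<close>, \<open>g\<close>, \<open>h\<close>, \<open>\<omega>\<close>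
  are finite, so that no sum of opposite infinities occurs in \<open>S\<close> and \<open>S\<^sub>\<rho>\<close>.\<close>

definition S_fun ::
  "('a \<Rightarrow> ereal) \<Rightarrow> ('a \<Rightarrow> ereal) \<Rightarrow> ('b \<Rightarrow> ereal) \<Rightarrow> ('a \<Rightarrow> 'b \<Rightarrow> real) \<Rightarrow> 'a \<Rightarrow> 'b \<Rightarrow> ereal" where
  "S_fun f g h \<Phi> x l = f x + g x + ereal (\<Phi> x l) - h l"

definition S_reg :: "('a \<Rightarrow> 'b \<Rightarrow> ereal) \<Rightarrow> ('b \<Rightarrow> ereal) \<Rightarrow> real \<Rightarrow> 'a \<Rightarrow> 'b \<Rightarrow> ereal" where
  "S_reg S \<omega> \<rho> x l = S x l - ereal \<rho> * \<omega> l"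

definition psi_P :: "'b set \<Rightarrow> ('a \<Rightarrow> 'b \<Rightarrow> ereal) \<Rightarrow> 'a \<Rightarrow> ereal" where
  "psi_P \<Lambda> S x = (SUP l\<in>\<Lambda>. S x l)"

definition psi_D :: "'a set \<Rightarrow> ('a \<Rightarrow> 'b \<Rightarrow> ereal) \<Rightarrow> 'b \<Rightarrow> ereal" where
  "psi_D X S l = (INF x\<in>X. S x l)"

definition gap :: "'a set \<Rightarrow> 'b set \<Rightarrow> ('a \<Rightarrow> 'b \<Rightarrow> ereal) \<Rightarrow> 'a \<Rightarrow> 'b \<Rightarrow> ereal" where
  "gap X \<Lambda> S x l = psi_P \<Lambda> S x - psi_D X S l"

text \<open>Only the primal function is regularized in the regularized gap.\<close>

definition gap_reg ::
  "'a set \<Rightarrow> 'b set \<Rightarrow> ('a \<Rightarrow> 'b \<Rightarrow> ereal) \<Rightarrow> ('b \<Rightarrow> ereal) \<Rightarrow> real \<Rightarrow> 'a \<Rightarrow> 'b \<Rightarrow> ereal" where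
  "gap_reg X \<Lambda> S \<omega> \<rho> x l = psi_P \<Lambda> (S_reg S \<omega> \<rho>) x - psi_D X S l"

locale saddle_problem =
  fixes X :: "'a::finite_dim_normed set" and \<Lambda> :: "'b::finite_dim_normed set"
    and f g :: "'a \<Rightarrow> ereal" and h :: "'b \<Rightarrow> ereal" and \<Phi> :: "'a \<Rightarrow> 'b \<Rightarrow> real"
    and \<omega> :: "'b \<Rightarrow> ereal"
    and \<mu> L L\<^sub>x\<^sub>x L\<^sub>l\<^sub>x L\<^sub>l\<^sub>l :: real
  assumes X: "X \<noteq> {}" "closed X" "convex X" "bounded X"
    and \<Lambda>: "\<Lambda> \<noteq> {}" "closed \<Lambda>" "convex \<Lambda>"
    and f: "convex_closed_proper f"
    and g: "convex_closed_proper g" "X \<subseteq> effdom g"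
    and h: "convex_closed_proper h" "\<Lambda> \<subseteq> effdom h"
    and f_diff: "\<exists>U. open U \<and> X \<subseteq> U \<and> ereal_differentiable_on f U"
    and \<mu>_L: "0 < \<mu>" "\<mu> \<le> L"
    and f_lower: "\<And>x x'. x \<in> X \<Longrightarrow> x' \<in> X \<Longrightarrow>
        \<mu> / 2 * (norm (x - x'))\<^sup>2
          \<le> real_val f x - real_val f x' - blinfun_apply (grad (real_val f) x') (x - x')"
    and f_upper: "\<And>x x'. x \<in> X \<Longrightarrow> x' \<in> X \<Longrightarrow>
        real_val f x - real_val f x' - blinfun_apply (grad (real_val f) x') (x - x')
          \<le> L / 2 * (norm (x - x'))\<^sup>2"
    and \<Phi>_convex: "\<And>l. convex_on UNIV (\<lambda>x. \<Phi> x l)"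
    and \<Phi>_concave: "\<And>x. concave_on UNIV (\<lambda>l. \<Phi> x l)"
    and \<Phi>_diff_x: "\<And>x l. (\<lambda>x. \<Phi> x l) differentiable (at x)"
    and \<Phi>_diff_l: "\<And>x l. (\<lambda>l. \<Phi> x l) differentiable (at l)"
    and \<Phi>_xx: "\<And>x x' l. x \<in> X \<Longrightarrow> x' \<in> X \<Longrightarrow> l \<in> \<Lambda> \<Longrightarrow>
        norm (grad (\<lambda>x. \<Phi> x l) x - grad (\<lambda>x. \<Phi> x l) x') \<le> L\<^sub>x\<^sub>x * norm (x - x')"
    and \<Phi>_xl: "\<And>x l l'. x \<in> X \<Longrightarrow> l \<in> \<Lambda> \<Longrightarrow> l' \<in> \<Lambda> \<Longrightarrow>
        norm (grad (\<lambda>x. \<Phi> x l) x - grad (\<lambda>x. \<Phi> x l') x) \<le> L\<^sub>l\<^sub>x * norm (l - l')"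
    and \<Phi>_lx: "\<And>x x' l. x \<in> X \<Longrightarrow> x' \<in> X \<Longrightarrow> l \<in> \<Lambda> \<Longrightarrow>
        norm (grad (\<lambda>l. \<Phi> x l) l - grad (\<lambda>l. \<Phi> x' l) l) \<le> L\<^sub>l\<^sub>x * norm (x - x')"
    and \<Phi>_ll: "\<And>x l l'. x \<in> X \<Longrightarrow> l \<in> \<Lambda> \<Longrightarrow> l' \<in> \<Lambda> \<Longrightarrow>
        norm (grad (\<lambda>l. \<Phi> x l) l - grad (\<lambda>l. \<Phi> x l) l') \<le> L\<^sub>l\<^sub>l * norm (l - l')"
    and saddle: "\<exists>xs\<in>X. \<exists>ls\<in>\<Lambda>. \<forall>x\<in>X. \<forall>l\<in>\<Lambda>.
        S_fun f g h \<Phi> xs l \<le> S_fun f g h \<Phi> xs ls \<and> S_fun f g h \<Phi> xs ls \<le> S_fun f g h \<Phi> x ls"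
    and \<omega>: "convex_closed_proper \<omega>" "\<Lambda> \<subseteq> effdom \<omega>" "continuous_on \<Lambda> \<omega>"
    and \<omega>_strong: "strongly_convex_on 1 \<Lambda> \<omega>"
    and \<omega>_smooth: "essentially_smooth \<omega>"


section \<open>The randomized algorithm\<close>

text \<open>The sigma-algebra generated by \<open>F\<close> and the random vector \<open>Y\<close>.\<close>

definition adjoin :: "'w measure \<Rightarrow> ('w \<Rightarrow> 'c::topological_space) \<Rightarrow> 'w measure" where
  "adjoin F Y = sigma (space F) (sets F \<union> {Y -` A \<inter> space F | A. A \<in> sets borel})"

text \<open>In what follows, \<open>lt k\<close>, \<open>xt k\<close> and \<open>lt' k\<close> are the outputs of the three randomized
  methods called in iteration \<open>k\<close>, in this order, as random vectors on \<open>M\<close>; \<open>filt0 k\<close>,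
  \<open>filt1 k\<close>, \<open>filt2 k\<close> are the sigma-algebras of the information available just before each of
  these three calls.\<close>

primrec filt0 ::
  "'w measure \<Rightarrow> (nat \<Rightarrow> 'w \<Rightarrow> 'b::topological_space) \<Rightarrow> (nat \<Rightarrow> 'w \<Rightarrow> 'a::topological_space)
    \<Rightarrow> (nat \<Rightarrow> 'w \<Rightarrow> 'b) \<Rightarrow> nat \<Rightarrow> 'w measure" where
  "filt0 M lt xt lt' 0 = sigma (space M) {}"
| "filt0 M lt xt lt' (Suc k) =
     adjoin (adjoin (adjoin (filt0 M lt xt lt' k) (lt k)) (xt k)) (lt' k)"

definition filt1 where
  "filt1 M lt xt lt' k = adjoin (filt0 M lt xt lt' k) (lt k)"

definition filt2 where
  "filt2 M lt xt lt' k = adjoin (filt1 M lt xt lt' k) (xt k)"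

text \<open>The conditional expectations are those of nonnegative extended real random variables: each
  inexactness is nonnegative because the corresponding output lies in \<open>\<Lambda>\<close>, respectively \<open>X\<close>.
  \<open>nn_cond_exp\<close> is 0 by convention for a non-measurable argument; this does not occur here,
  since \<open>\<Phi>\<close> is continuous on \<open>X \<times> \<Lambda>\<close>, \<open>f\<close>, \<open>g\<close>, \<open>h\<close>, \<open>\<omega>\<close> are lower semicontinuous, the
  primal (dual) functions are lower (upper) semicontinuous on \<open>X\<close> (\<open>\<Lambda>\<close>), and \<open>x k\<close>,
  \<open>l k\<close>, \<open>lhat k\<close> are Borel.\<close>

locale randomized_IPDS =
  saddle_problem X \<Lambda> f g h \<Phi> \<omega> \<mu> L L\<^sub>x\<^sub>x L\<^sub>l\<^sub>x L\<^sub>l\<^sub>l + prob_space M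
  for X :: "'a::finite_dim_normed set" and \<Lambda> :: "'b::finite_dim_normed set"
    and f g h \<Phi> \<omega> \<mu> L L\<^sub>x\<^sub>x L\<^sub>l\<^sub>x L\<^sub>l\<^sub>l and M :: "'w measure" +
  fixes \<rho> \<eta> \<gamma> \<tau> :: "nat \<Rightarrow> real" and x0 :: 'a and l0 :: 'b
    and lt lt' :: "nat \<Rightarrow> 'w \<Rightarrow> 'b" and xt :: "nat \<Rightarrow> 'w \<Rightarrow> 'a"
    and x :: "nat \<Rightarrow> 'w \<Rightarrow> 'a" and l lhat :: "nat \<Rightarrow> 'w \<Rightarrow> 'b"
  assumes inputs: "\<rho> 0 > 0" "\<And>k. \<eta> k \<ge> 0" "\<And>k. \<gamma> k \<ge> 0" "\<And>k. \<tau> k \<in> {0<..<1}"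
    and start: "x0 \<in> X" "l0 \<in> \<Lambda>" "\<And>w. x 0 w = x0" "\<And>w. l 0 w = l0"
    and random: "\<And>k. lt k \<in> borel_measurable M" "\<And>k. xt k \<in> borel_measurable M"
      "\<And>k. lt' k \<in> borel_measurable M"
    and feasible: "\<And>k w. w \<in> space M \<Longrightarrow> lt k w \<in> \<Lambda>" "\<And>k w. w \<in> space M \<Longrightarrow> xt k w \<in> X"
      "\<And>k w. w \<in> space M \<Longrightarrow> lt' k w \<in> \<Lambda>"
    and step1: "\<And>k. AE w in M. nn_cond_exp M (filt0 M lt xt lt' k)
        (\<lambda>w. e2ennreal (psi_P \<Lambda> (S_reg (S_fun f g h \<Phi>) \<omega> (\<rho> k)) (x k w)
                         - S_reg (S_fun f g h \<Phi>) \<omega> (\<rho> k) (x k w) (lt k w))) w \<le> ennreal (\<eta> k)"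
    and step2: "\<And>k w. lhat k w = \<tau> k *\<^sub>R l k w + (1 - \<tau> k) *\<^sub>R lt k w"
    and step3: "\<And>k. AE w in M. nn_cond_exp M (filt1 M lt xt lt' k)
        (\<lambda>w. e2ennreal (S_fun f g h \<Phi> (xt k w) (lhat k w)
                         - psi_D X (S_fun f g h \<Phi>) (lhat k w))) w \<le> ennreal (\<gamma> k)"
    and step4: "\<And>k w. x (Suc k) w = \<tau> k *\<^sub>R x k w + (1 - \<tau> k) *\<^sub>R xt k w"
    and step5: "\<And>k. \<rho> (Suc k) = \<tau> k * \<rho> k"
    and step6: "\<And>k. AE w in M. nn_cond_exp M (filt2 M lt xt lt' k)
        (\<lambda>w. e2ennreal (psi_P \<Lambda> (S_reg (S_fun f g h \<Phi>) \<omega> (\<rho> (Suc k))) (x (Suc k) w)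
                         - S_reg (S_fun f g h \<Phi>) \<omega> (\<rho> (Suc k)) (x (Suc k) w) (lt' k w))) w
          \<le> ennreal (\<eta> k)"
    and step7: "\<And>k w. l (Suc k) w = \<tau> k *\<^sub>R l k w + (1 - \<tau> k) *\<^sub>R lt' k w"

end

theory Submission
  imports Defs
begin

text \<open>The proof is a convergence analysis of a smoothing scheme in which the regularization weight
\<open>\<rho>\<close> and the gap decrease together. Write \<open>S\<close> for the saddle function, \<open>S\<^sub>\<rho>\<close> for its
regularization, \<open>P\<^sub>\<rho>\<close> for the regularized primal function and \<open>D\<close> for the dual function. One
iteration with parameter \<open>\<tau>\<close> and the three inexactness errors
\<open>a\<close> (first dual call), \<open>b\<close> (primal call) and \<open>c\<close> (second dual call) satisfies, for every outcome,
\<open>P\<^sub>\<tau>\<^sub>\<rho>(x') - D(l') \<le> \<tau> (P\<^sub>\<rho>(x) - D(l)) + \<tau> a + 2 b + c\<close> (lemma \<open>one_step\<close>). The proof combines four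
inequalities: convexity of \<open>S\<close> in the first variable bounds \<open>P\<^sub>\<tau>\<^sub>\<rho>(x')\<close>; concavity of \<open>\<Phi>\<close> in the second
variable bounds \<open>S\<close> and \<open>D\<close> from above by the linearization at \<open>lhat\<close>; lemma \<open>inexact_oracle\<close> bounds
\<open>D(l')\<close> from below by the same linearization up to \<open>2 b\<close> and a quadratic term
\<open>L\<^sub>D (1 - \<tau>)\<^sup>2 d\<^sup>2\<close>, where \<open>d\<close> is the distance of the two dual outputs; and strong concavity of
\<open>S\<^sub>\<rho>\<close> in the second variable supplies \<open>\<tau> \<rho> d\<^sup>2 / 4\<close>, which absorbs the quadratic term as soon as
\<open>4 L\<^sub>D (1 - \<tau>)\<^sup>2 \<le> \<tau> \<rho>\<close>.

Within an iteration, strong convexity compares two approximate optimizers through their midpoint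
(lemma \<open>sconvex_on_midpoint\<close>), which takes the place of the growth condition around an exact one.

The chosen parameters give \<open>\<rho>\<^sub>k = 16 L\<^sub>D / ((k+1)(k+2))\<close>, for which the absorption condition holds.
The errors have expectation at most \<open>\<eta>\<^sub>k\<close>, \<open>\<gamma>\<^sub>k\<close>, \<open>\<eta>\<^sub>k\<close> because a conditional expectation has the same
mean as the variable itself. Multiplying the recursion for the expected gap by \<open>(k+2)(k+3)\<close> makes it
telescope (lemma \<open>gap_reg_bound\<close>). For bounded \<open>\<Lambda>\<close> the function \<open>\<omega>\<close> is bounded by
\<open>B\<^sub>\<omega>\<close> on \<open>\<Lambda>\<close>, so that the regularized and the plain gap differ by at most \<open>\<rho> B\<^sub>\<omega>\<close>, once at
iteration \<open>K\<close> and once at the start.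

What remains is to see that all quantities are finite, measurable and integrable. The values are
finite because a strongly convex function that is bounded below near one point is bounded below
everywhere (lemma \<open>sconvex_on_bounded_below\<close>). The primal function is lower and the dual
function upper semicontinuous, and \<open>\<Phi>\<close> is jointly continuous on \<open>X \<times> \<Lambda>\<close>, hence measurability. The
gap is bounded above by the recursion and below by a constant coming from the saddle point.\<close>

section \<open>Compactness in finite-dimensional normed spaces\<close>

text \<open>By induction on the spanning set. Because the span of the smaller set is closed, a new vector \<open>b\<close>
outside it has positive distance from it; this bounds the coefficient of \<open>b\<close>, and the
coefficients and the remainders can be made to converge one after the other.\<close>

lemma bounded_seq_in_finite_span:
  fixes B :: "'a::real_normed_vector set" and u :: "nat \<Rightarrow> 'a"
  assumes "finite B" "\<And>n. u n \<in> span B" "bounded (range u)"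
  shows "\<exists>p\<in>span B. \<exists>r. strict_mono r \<and> (u \<circ> r) \<longlonglongrightarrow> p"
  using assms
proof (induction B arbitrary: u rule: finite_induct)
  case empty
  then have "u = (\<lambda>_. 0)" by auto
  then show ?case
    by (auto intro!: exI[of _ id] simp: strict_mono_id o_def)
next
  case (insert b B)
  show ?case
  proof (cases "b \<in> span B")
    case True
    then have "span (insert b B) = span B"
      by (rule span_redundant)
    then show ?thesis using insert by simp
  next
    case False
    have "closed (span B)"
      unfolding closed_sequential_limits
    proof (intro allI impI, elim conjE)
      fix s p assume s: "\<forall>n. s n \<in> span B" "s \<longlonglongrightarrow> p"
      then have "bounded (range s)"
        by (simp add: convergent_imp_bounded)
      with insert.IH[of s] s obtain q r where "q \<in> span B" "strict_mono r" "(s \<circ> r) \<longlonglongrightarrow> q"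
        by blast
      moreover from this have "(s \<circ> r) \<longlonglongrightarrow> p"
        using s LIMSEQ_subseq_LIMSEQ by blast
      ultimately show "p \<in> span B"
        using LIMSEQ_unique by blast
    qed
    then have d: "infdist b (span B) > 0"
      using False in_closed_iff_infdist_zero[of "span B" b] infdist_nonneg[of b "span B"] span_zero
      by (metis empty_iff less_eq_real_def)
    obtain c where c: "\<And>n. u n - c n *\<^sub>R b \<in> span B"
      using insert.prems(1) unfolding span_breakdown_eq by metis
    define y where "y = (\<lambda>n. u n - c n *\<^sub>R b)"
    have cb: "\<bar>c n\<bar> * infdist b (span B) \<le> norm (u n)" for n
    proof (cases "c n = 0")
      case False
      have "- (1 / c n) *\<^sub>R y n \<in> span B"
        using c unfolding y_def by (rule span_scale)
      then have "infdist b (span B) \<le> norm (b - (- (1 / c n) *\<^sub>R y n))"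
        using infdist_le[of "- (1 / c n) *\<^sub>R y n" "span B" b] by (simp only: dist_norm)
      then have "\<bar>c n\<bar> * infdist b (span B) \<le> norm (c n *\<^sub>R (b - (- (1 / c n) *\<^sub>R y n)))"
        by (simp add: mult_left_mono)
      also have "c n *\<^sub>R (b - (- (1 / c n) *\<^sub>R y n)) = u n"
        using False by (simp add: y_def algebra_simps)
      finally show ?thesis .
    qed simp
    obtain b0 where b0: "\<And>n. norm (u n) \<le> b0"
      using insert.prems(2) unfolding bounded_iff by auto
    have "\<bar>c n\<bar> \<le> b0 / infdist b (span B)" for n
      using cb[of n] b0[of n] d by (simp add: field_simps)
    then have "bounded (range c)"
      unfolding bounded_iff by auto
    then obtain p r where r: "strict_mono r" "(c \<circ> r) \<longlonglongrightarrow> p"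
      using bounded_imp_convergent_subsequence by blast
    have "bounded (range y)"
    proof -
      have "norm (y n) \<le> b0 + b0 / infdist b (span B) * norm b" for n
        unfolding y_def using norm_triangle_ineq4[of "u n" "c n *\<^sub>R b"] b0[of n]
          mult_right_mono[OF \<open>\<bar>c n\<bar> \<le> b0 / infdist b (span B)\<close> norm_ge_zero[of b]]
        by simp
      then show ?thesis unfolding bounded_iff by auto
    qed
    then have "bounded (range (y \<circ> r))"
      by (rule bounded_subset) auto
    moreover have "(y \<circ> r) n \<in> span B" for n
      using c by (simp add: y_def)
    ultimately obtain q s where s: "q \<in> span B" "strict_mono s" "(y \<circ> r \<circ> s) \<longlonglongrightarrow> q"
      using insert.IH[of "y \<circ> r"] by blast
    have "(c \<circ> r \<circ> s) \<longlonglongrightarrow> p"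
      using r(2) s(2) by (rule LIMSEQ_subseq_LIMSEQ)
    then have "(\<lambda>n. (c \<circ> r \<circ> s) n *\<^sub>R b + (y \<circ> r \<circ> s) n) \<longlonglongrightarrow> p *\<^sub>R b + q"
      using s(3) by (intro tendsto_intros)
    moreover have "(\<lambda>n. (c \<circ> r \<circ> s) n *\<^sub>R b + (y \<circ> r \<circ> s) n) = u \<circ> (r \<circ> s)"
      by (auto simp: y_def)
    moreover have "p *\<^sub>R b + q \<in> span (insert b B)"
      using s(1) unfolding span_breakdown_eq by (auto intro!: exI[of _ p])
    ultimately show ?thesis
      using r(1) s(2) strict_mono_o by metis
  qed
qed

text \<open>This makes bounded closed sets compact, which is what bounds \<open>\<omega>\<close> on a bounded \<open>\<Lambda>\<close>.\<close>

instance finite_dim_normed \<subseteq> heine_borel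
proof
  fix u :: "nat \<Rightarrow> 'a" assume "bounded (range u)"
  obtain B :: "'a set" where B: "finite B" "\<And>x. \<exists>c. x = (\<Sum>b\<in>B. c b *\<^sub>R b)"
    using finite_dim by metis
  have "x \<in> span B" for x
    using B(2)[of x] by (auto intro!: span_sum span_scale intro: span_base)
  then show "\<exists>l r. strict_mono r \<and> (u \<circ> r) \<longlonglongrightarrow> l"
    using bounded_seq_in_finite_span[OF B(1) _ \<open>bounded (range u)\<close>] by blast
qed

section \<open>Strongly convex functions\<close>

text \<open>The real-valued companion of \<open>strongly_convex_on\<close>. Modulus 0 is ordinary convexity, so that sums of
convex and strongly convex terms are handled by the single rule \<open>sconvex_on_add\<close>.\<close>

definition sconvex_on :: "real \<Rightarrow> 'a::real_normed_vector set \<Rightarrow> ('a \<Rightarrow> real) \<Rightarrow> bool" where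
  "sconvex_on m C F \<longleftrightarrow>
     (\<forall>x\<in>C. \<forall>y\<in>C. \<forall>t\<in>{0..1}. F ((1 - t) *\<^sub>R x + t *\<^sub>R y)
        \<le> (1 - t) * F x + t * F y - m / 2 * t * (1 - t) * (norm (x - y))\<^sup>2)"

lemma sconvex_onD:
  assumes "sconvex_on m C F" "x \<in> C" "y \<in> C" "0 \<le> t" "t \<le> 1"
  shows "F ((1 - t) *\<^sub>R x + t *\<^sub>R y) \<le> (1 - t) * F x + t * F y - m / 2 * t * (1 - t) * (norm (x - y))\<^sup>2"
  using assms unfolding sconvex_on_def by auto

lemma sconvex_on_add:
  assumes "sconvex_on m C F" "sconvex_on n C G"
  shows "sconvex_on (m + n) C (\<lambda>x. F x + G x)"
  unfolding sconvex_on_def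
proof (intro ballI)
  fix x y t assume *: "x \<in> C" "y \<in> C" "t \<in> {0..1::real}"
  show "F ((1 - t) *\<^sub>R x + t *\<^sub>R y) + G ((1 - t) *\<^sub>R x + t *\<^sub>R y)
    \<le> (1 - t) * (F x + G x) + t * (F y + G y) - (m + n) / 2 * t * (1 - t) * (norm (x - y))\<^sup>2"
    using sconvex_onD[OF assms(1), of x y t] sconvex_onD[OF assms(2), of x y t] *
    by (simp add: algebra_simps add_divide_distrib)
qed

lemma sconvex_on_cmult:
  assumes "sconvex_on m C F" "0 \<le> a"
  shows "sconvex_on (a * m) C (\<lambda>x. a * F x)"
  unfolding sconvex_on_def
proof (intro ballI)
  fix x y t assume *: "x \<in> C" "y \<in> C" "t \<in> {0..1::real}"
  show "a * F ((1 - t) *\<^sub>R x + t *\<^sub>R y)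
    \<le> (1 - t) * (a * F x) + t * (a * F y) - a * m / 2 * t * (1 - t) * (norm (x - y))\<^sup>2"
    using mult_left_mono[OF sconvex_onD[OF assms(1), of x y t] assms(2)] *
    by (simp add: algebra_simps)
qed

lemma sconvex_on_convex:
  assumes "convex_on C F"
  shows "sconvex_on 0 C F"
  using assms unfolding sconvex_on_def convex_on_def by auto

lemma sconvex_on_cong:
  assumes "\<And>x. x \<in> C \<Longrightarrow> F x = G x" "convex C"
  shows "sconvex_on m C F \<longleftrightarrow> sconvex_on m C G"
  using assms unfolding sconvex_on_def convex_alt by auto

lemma sconvex_on_const: "sconvex_on 0 C (\<lambda>_. c)"
  unfolding sconvex_on_def by (simp add: algebra_simps)

text \<open>Two points whose values are close to a lower bound are close to each other: otherwise the
value at their midpoint would fall below that bound. With \<open>c\<close> the infimum this replaces the usual growth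
estimate around a minimizer.\<close>

lemma sconvex_on_midpoint:
  assumes "sconvex_on m C F" "convex C" "\<And>z. z \<in> C \<Longrightarrow> c \<le> F z" "x \<in> C" "y \<in> C"
  shows "m / 4 * (norm (x - y))\<^sup>2 \<le> (F x - c) + (F y - c)"
proof -
  have "(1 - 1/2) *\<^sub>R x + (1/2) *\<^sub>R y \<in> C"
    using assms(2,4,5) unfolding convex_alt by (metis less_eq_real_def half_gt_zero_iff divide_le_eq_1_pos zero_less_one one_le_numeral zero_less_numeral)
  from assms(3)[OF this] sconvex_onD[OF assms(1,4,5), of "1/2"]
  show ?thesis by simp
qed

text \<open>A point \<open>y\<close> at distance \<open>R > r\<close> is compared with the point of the segment from \<open>x\<close> to \<open>y\<close> at
distance \<open>r / 2\<close> from \<open>x\<close>, where \<open>F\<close> is at least \<open>c\<close>. This gives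
\<open>F y \<ge> F x - D R + m R\<^sup>2 / 4\<close> with a constant \<open>D\<close>, and the quadratic in \<open>R\<close> is bounded below.\<close>

lemma sconvex_on_bounded_below:
  assumes F: "sconvex_on m C F" and m: "m > 0" and C: "convex C" "x \<in> C"
    and r: "r > 0" "\<And>z. z \<in> C \<Longrightarrow> dist x z \<le> r \<Longrightarrow> c \<le> F z"
  obtains b where "\<And>y. y \<in> C \<Longrightarrow> b \<le> F y"
proof -
  define D where "D = 2 * (F x - c) / r"
  have "min c (F x - D\<^sup>2 / m) \<le> F y" if y: "y \<in> C" for y
  proof (cases "dist x y \<le> r")
    case True then show ?thesis using r(2)[OF y] by simp
  next
    case False
    define R where "R = norm (x - y)"
    \<comment> \<open>This parameter puts the point of the segment at distance \<open>r / 2\<close> from \<open>x\<close>.\<close>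
    define t where "t = r / (2 * R)"
    have R: "R > r" "R > 0" using False r(1) by (auto simp: R_def dist_norm)
    then have t: "0 < t" "t \<le> 1/2" using r(1) by (auto simp: t_def field_simps)
    have tR: "t * R = r / 2" using R by (simp add: t_def)
    let ?z = "(1 - t) *\<^sub>R x + t *\<^sub>R y"
    have "?z \<in> C" using C y t unfolding convex_alt by auto
    moreover have "x - ?z = t *\<^sub>R (x - y)" by (simp add: algebra_simps)
    then have "dist x ?z = t * R" using t by (simp add: dist_norm R_def)
    then have "dist x ?z \<le> r" using tR r(1) by simp
    ultimately have "c \<le> F ?z" by (rule r(2))
    also have "\<dots> \<le> (1 - t) * F x + t * F y - m / 2 * t * (1 - t) * R\<^sup>2"
      unfolding R_def using sconvex_onD[OF F C(2) y] t by simp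
    finally have 1: "t * (F y - F x) \<ge> (c - F x) + m / 2 * t * (1 - t) * R\<^sup>2"
      by (simp add: algebra_simps)
    have "m / 2 * t * R\<^sup>2 * (1 - t) \<ge> m / 2 * t * R\<^sup>2 * (1/2)"
      using t m by (intro mult_left_mono) auto
    moreover have "c - F x = - t * (D * R)"
    proof -
      have "t * (D * R) = D * (t * R)" by simp
      also have "\<dots> = F x - c" unfolding tR D_def using r(1) by (simp add: field_simps)
      finally show ?thesis by simp
    qed
    moreover have "m / 2 * t * (1 - t) * R\<^sup>2 = m / 2 * t * R\<^sup>2 * (1 - t)" by simp
    ultimately have "t * (F y - F x) \<ge> - t * (D * R) + m / 2 * t * R\<^sup>2 * (1/2)"
      using 1 by linarith
    then have "t * (F y - F x) \<ge> t * (m / 4 * R\<^sup>2 - D * R)"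
      by (simp add: right_diff_distrib mult_ac)
    then have "F y - F x \<ge> m / 4 * R\<^sup>2 - D * R" using t by simp
    moreover have "m / 4 * R\<^sup>2 - D * R + D\<^sup>2 / m = m * (R / 2 - D / m)\<^sup>2"
      using m by (simp add: field_simps power2_eq_square)
    moreover have "m * (R / 2 - D / m)\<^sup>2 \<ge> 0" using m by simp
    ultimately have "F y \<ge> F x - D\<^sup>2 / m" by linarith
    then show ?thesis by simp
  qed
  then show ?thesis using that by blast
qed

section \<open>Closed convex functions\<close>

lemma closed_sublevel:
  assumes "closed (epigraph F)"
  shows "closed {x. F x \<le> ereal c}"
proof -
  have "{x. F x \<le> ereal c} = (\<lambda>x. (x, c)) -` epigraph F"
    by (auto simp: epigraph_def)
  then show ?thesis
    using assms by (simp add: closed_vimage continuous_intros)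
qed

lemma closed_proper_locally_bounded_below:
  assumes "convex_closed_proper F"
  obtains r c where "r > 0" "\<And>z. dist x z \<le> r \<Longrightarrow> ereal c \<le> F z"
proof -
  obtain c where c: "ereal c < F x"
    using assms unfolding convex_closed_proper_def by (metis ereal_dense2 ereal_infty_less(2))
  have "open (- {x. F x \<le> ereal c})"
    using assms by (intro open_Compl closed_sublevel) (simp add: convex_closed_proper_def)
  moreover have "x \<in> - {x. F x \<le> ereal c}" using c by simp
  ultimately obtain r where r: "r > 0" "cball x r \<subseteq> - {x. F x \<le> ereal c}"
    using open_contains_cball by blast
  have "ereal c \<le> F z" if "dist x z \<le> r" for z
  proof -
    have "z \<in> - {x. F x \<le> ereal c}" using r(2) that by (auto simp: subset_iff)
    then show ?thesis by simp
  qed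
  then show ?thesis by (rule that[OF r(1)])
qed

text \<open>Both the saddle function in its first variable and the negative regularized saddle function in its second
variable have this form near any point.\<close>

lemma locally_bounded_below_sum:
  assumes F: "convex_closed_proper F" and G: "convex_closed_proper G"
    and fin: "\<And>z. z \<in> C \<Longrightarrow> F z = ereal (real_val F z)" "\<And>z. z \<in> C \<Longrightarrow> G z = ereal (real_val G z)"
    and a: "0 \<le> a" and p: "continuous_on UNIV p"
  obtains r c where "r > 0"
    "\<And>z. z \<in> C \<Longrightarrow> dist x z \<le> r \<Longrightarrow> c \<le> real_val F z + a * real_val G z + p z"
proof -
  obtain r1 c1 where 1: "r1 > 0" "\<And>z. dist x z \<le> r1 \<Longrightarrow> ereal c1 \<le> F z"
    using closed_proper_locally_bounded_below[OF F] by blast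
  obtain r2 c2 where 2: "r2 > 0" "\<And>z. dist x z \<le> r2 \<Longrightarrow> ereal c2 \<le> G z"
    using closed_proper_locally_bounded_below[OF G] by blast
  have "isCont p x"
    using p continuous_on_eq_continuous_at open_UNIV by blast
  then obtain r3 where 3: "r3 > 0" "\<And>z. dist z x < r3 \<Longrightarrow> dist (p z) (p x) < 1"
    unfolding continuous_at_eps_delta by (metis zero_less_one)
  define r where "r = min r1 (min r2 (r3 / 2))"
  show ?thesis
  proof (rule that[of r "c1 + a * c2 + (p x - 1)"])
    show "r > 0" using 1(1) 2(1) 3(1) by (simp add: r_def)
    fix z assume z: "z \<in> C" "dist x z \<le> r"
    have "dist (p z) (p x) < 1" using 3 z(2) by (intro 3(2)) (simp add: r_def dist_commute)
    moreover have "c1 \<le> real_val F z"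
      using 1(2)[of z] z(2) fin(1)[OF z(1)] unfolding r_def by (metis ereal_less_eq(3) min.bounded_iff)
    moreover have "c2 \<le> real_val G z"
      using 2(2)[of z] z(2) fin(2)[OF z(1)] unfolding r_def by (metis ereal_less_eq(3) min.bounded_iff)
    then have "a * c2 \<le> a * real_val G z" using a by (rule mult_left_mono)
    ultimately show "c1 + a * c2 + (p x - 1) \<le> real_val F z + a * real_val G z + p z"
      by (simp add: dist_real_def)
  qed
qed

lemma convex_epigraphD:
  assumes "convex (epigraph F)" "F x = ereal a" "F y = ereal b" "0 \<le> t" "t \<le> 1"
  shows "F ((1 - t) *\<^sub>R x + t *\<^sub>R y) \<le> ereal ((1 - t) * a + t * b)"
proof -
  have "(1 - t) *\<^sub>R (x, a) + t *\<^sub>R (y, b) \<in> epigraph F"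
    using assms unfolding convex_alt by (auto simp: epigraph_def)
  then show ?thesis by (simp add: epigraph_def)
qed

text \<open>The one-dimensional tangent inequality along the line through \<open>x\<close> and \<open>y\<close>.\<close>

lemma concave_on_gradient:
  assumes "concave_on UNIV F" "F differentiable (at x)"
  shows "F y \<le> F x + blinfun_apply (grad F x) (y - x)"
proof -
  have d: "(F has_derivative frechet_derivative F (at x)) (at x)"
    using assms(2) frechet_derivative_works by blast
  then have "bounded_linear (frechet_derivative F (at x))"
    by (rule has_derivative_bounded_linear)
  then have g: "(F has_derivative blinfun_apply (grad F x)) (at x)"
    using d by (simp add: grad_def bounded_linear_Blinfun_apply)
  define p where "p = (\<lambda>t. - F (x + t *\<^sub>R (y - x)))"
  have "(p has_derivative (\<lambda>t. - blinfun_apply (grad F x) (t *\<^sub>R (y - x)))) (at 0)"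
    unfolding p_def
    by (intro has_derivative_minus has_derivative_compose[of "\<lambda>t. x + t *\<^sub>R (y - x)" _ _ _ F])
       (use g in \<open>auto intro!: derivative_eq_intros\<close>)
  then have dp: "(p has_field_derivative - blinfun_apply (grad F x) (y - x)) (at 0 within UNIV)"
    unfolding has_field_derivative_def
    by (rule has_derivative_eq_rhs) (auto simp: blinfun.scaleR_right)
  have "convex_on UNIV p"
  proof (rule convex_onI)
    fix t a b :: real assume t: "0 < t" "t < 1"
    have "(1 - t) *\<^sub>R (x + a *\<^sub>R (y - x)) + t *\<^sub>R (x + b *\<^sub>R (y - x)) = x + ((1 - t) * a + t * b) *\<^sub>R (y - x)"
      by (simp add: algebra_simps)
    then show "p ((1 - t) *\<^sub>R a + t *\<^sub>R b) \<le> (1 - t) * p a + t * p b"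
      using convex_onD[OF assms(1)[unfolded concave_on_def], of t "x + a *\<^sub>R (y - x)" "x + b *\<^sub>R (y - x)"] t
      by (simp add: p_def)
  qed simp
  from convex_on_imp_above_tangent[OF this _ _ _ dp, of 1]
  show ?thesis by (simp add: p_def)
qed

section \<open>Semicontinuity and measurability\<close>

lemma borel_measurable_lsc:
  fixes F :: "'a::topological_space \<Rightarrow> ereal"
  assumes "\<And>c. closed {x. F x \<le> ereal c}"
  shows "F \<in> borel_measurable borel"
  unfolding borel_measurable_iff_Iic_ereal
proof
  fix a
  have "closed {x. F x \<le> a}"
  proof (cases a)
    case MInf
    have "{x. F x \<le> - \<infinity>} = (\<Inter>n::nat. {x. F x \<le> ereal (- real n)})"
    proof (intro set_eqI iffI)
      fix x assume *: "x \<in> (\<Inter>n::nat. {x. F x \<le> ereal (- real n)})"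
      show "x \<in> {x. F x \<le> - \<infinity>}"
      proof (cases "F x")
        case (real r)
        obtain n where "- r < real n" using reals_Archimedean2 by blast
        moreover have "F x \<le> ereal (- real n)" using * by blast
        ultimately show ?thesis using real by simp
      next
        case PInf
        have "F x \<le> ereal (- real 0)" using * by blast
        with PInf show ?thesis by simp
      qed simp
    qed auto
    then show ?thesis using MInf assms by (simp add: closed_INT)
  qed (use assms in auto)
  moreover have "F -` {..a} \<inter> space borel = {x. F x \<le> a}" by auto
  ultimately show "F -` {..a} \<inter> space borel \<in> sets borel" by simp
qed

text \<open>\<open>F x + G x > c\<close> holds exactly if some real \<open>a\<close> satisfies \<open>F x > a\<close> and \<open>G x > c - a\<close>, so that the
complement is a union of open sets.\<close>

lemma closed_sublevel_add:
  fixes F G :: "'a::topological_space \<Rightarrow> ereal"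
  assumes F: "\<And>c. closed {x. F x \<le> ereal c}" "\<And>x. F x \<noteq> - \<infinity>"
    and G: "\<And>c. closed {x. G x \<le> ereal c}" "\<And>x. G x \<noteq> - \<infinity>"
  shows "closed {x. F x + G x \<le> ereal c}"
proof -
  have "- {x. F x + G x \<le> ereal c} = (\<Union>a. - {x. F x \<le> ereal a} \<inter> - {x. G x \<le> ereal (c - a)})"
  proof (intro set_eqI iffI)
    fix x assume "x \<in> - {x. F x + G x \<le> ereal c}"
    then have *: "F x + G x > ereal c" by simp
    obtain b where b: "ereal b < G x" using G(2)[of x] by (metis ereal_dense2 ereal_infty_less(2))
    obtain b' where b': "ereal b' < F x" using F(2)[of x] by (metis ereal_dense2 ereal_infty_less(2))
    have "\<exists>a. ereal a < F x \<and> ereal (c - a) < G x"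
    proof (cases "F x")
      case PInf with b show ?thesis by (intro exI[of _ "c - b"]) simp
    next
      case (real r)
      show ?thesis
      proof (cases "G x")
        case PInf with b' show ?thesis by auto
      next
        case (real s)
        with * \<open>F x = ereal r\<close> show ?thesis by (intro exI[of _ "(r + c - s) / 2"]) (simp add: field_simps)
      qed (use G in auto)
    qed (use F in auto)
    then show "x \<in> (\<Union>a. - {x. F x \<le> ereal a} \<inter> - {x. G x \<le> ereal (c - a)})" by (auto simp: not_le)
  next
    fix x assume "x \<in> (\<Union>a. - {x. F x \<le> ereal a} \<inter> - {x. G x \<le> ereal (c - a)})"
    then obtain a where "ereal a < F x" "ereal (c - a) < G x" by (auto simp: not_le)
    then show "x \<in> - {x. F x + G x \<le> ereal c}" by (cases "F x"; cases "G x") auto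
  qed
  moreover have "open (\<Union>a. - {x. F x \<le> ereal a} \<inter> - {x. G x \<le> ereal (c - a)})"
    using F(1) G(1) by (intro open_UN ballI open_Int) auto
  ultimately show ?thesis by (metis closed_def)
qed

lemma closed_sublevel_continuous:
  fixes p :: "'a::topological_space \<Rightarrow> real"
  assumes "continuous_on UNIV p"
  shows "closed {x. ereal (p x) \<le> ereal c}"
  using assms by (simp add: closed_Collect_le)

lemma closed_sublevel_SUP:
  fixes F :: "'b \<Rightarrow> 'a::topological_space \<Rightarrow> ereal"
  assumes "\<And>i. i \<in> I \<Longrightarrow> closed {x. F i x \<le> ereal c}"
  shows "closed {x. (SUP i\<in>I. F i x) \<le> ereal c}"
proof -
  have "{x. (SUP i\<in>I. F i x) \<le> ereal c} = (\<Inter>i\<in>I. {x. F i x \<le> ereal c})"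
    by (auto simp: SUP_le_iff)
  then show ?thesis using assms by (simp add: closed_INT)
qed

lemma closed_proper_borel:
  assumes "convex_closed_proper F"
  shows "F \<in> borel_measurable borel"
  using assms by (intro borel_measurable_lsc closed_sublevel) (simp add: convex_closed_proper_def)

section \<open>Conditional expectations\<close>

text \<open>A conditional expectation has the same integral as the variable itself, so that a bound for it, once
integrated, bounds the unconditional mean.\<close>

lemma (in prob_space) expectation_le_of_nn_cond_exp:
  assumes F: "subalgebra M F" and v: "v \<in> borel_measurable M"
    and u: "\<And>w. w \<in> space M \<Longrightarrow> 0 \<le> v w" "\<And>w. w \<in> space M \<Longrightarrow> u w = ennreal (v w)"
    and c: "0 \<le> c" "AE w in M. nn_cond_exp M F u w \<le> ennreal c"
  shows "integrable M v" "expectation v \<le> c"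
proof -
  interpret F: finite_measure_subalgebra M F by unfold_locales (rule F)
  have um: "u \<in> borel_measurable M"
    using v by (subst measurable_cong[OF u(2)]) auto
  have "(\<integral>\<^sup>+ w. ennreal (v w) \<partial>M) = (\<integral>\<^sup>+ w. 1 * u w \<partial>M)"
    using u(2) by (intro nn_integral_cong) simp
  also have "\<dots> = (\<integral>\<^sup>+ w. 1 * nn_cond_exp M F u w \<partial>M)"
    using um by (intro F.nn_cond_exp_intg[symmetric]) auto
  also have "\<dots> \<le> (\<integral>\<^sup>+ w. ennreal c \<partial>M)"
    using c(2) by (intro nn_integral_mono_AE) auto
  also have "\<dots> = ennreal c" by (simp add: emeasure_space_1)
  finally have le: "(\<integral>\<^sup>+ w. ennreal (v w) \<partial>M) \<le> ennreal c" .
  have nn: "AE w in M. 0 \<le> v w" using u(1) by simp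
  show int: "integrable M v"
    using v nn le by (intro integrableI_nonneg) (auto simp: le_less_trans[OF le])
  have "ennreal (expectation v) \<le> ennreal c"
    using le nn_integral_eq_integral[OF int nn] by simp
  then show "expectation v \<le> c" using c(1) by simp
qed

lemma subalgebra_adjoin:
  assumes "subalgebra M F" "Y \<in> borel_measurable M"
  shows "subalgebra M (adjoin F Y)"
proof -
  have "sigma_sets (space F) (sets F \<union> {Y -` A \<inter> space F |A. A \<in> sets borel}) \<subseteq> sets M"
    using assms measurable_sets[OF assms(2)] unfolding subalgebra_def
    by (intro sets.sigma_sets_subset') auto
  moreover have "sets F \<union> {Y -` A \<inter> space F |A. A \<in> sets borel} \<subseteq> Pow (space F)"
    using sets.sets_into_space by blast
  ultimately show ?thesis
    using assms(1) unfolding subalgebra_def adjoin_def by (simp add: sets_measure_of)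
qed

section \<open>Values of the saddle problem\<close>

lemma S_reg_0 [simp]: "S_reg S \<omega> 0 = S"
  by (auto simp: S_reg_def fun_eq_iff zero_ereal_def[symmetric])

lemma finite_INF_ereal:
  assumes "A \<noteq> {}" "\<And>x. x \<in> A \<Longrightarrow> G x = ereal (F x)" "\<And>x. x \<in> A \<Longrightarrow> b \<le> F x"
  shows "\<bar>INF x\<in>A. G x\<bar> \<noteq> \<infinity>"
proof -
  obtain a where a: "a \<in> A" using assms(1) by auto
  have "(INF x\<in>A. G x) \<le> ereal (F a)" using INF_lower[OF a, of G] assms(2)[OF a] by simp
  moreover have "ereal b \<le> (INF x\<in>A. G x)" by (rule INF_greatest) (use assms in auto)
  ultimately show ?thesis by (cases "INF x\<in>A. G x") auto
qed

lemma finite_SUP_ereal: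
  assumes "A \<noteq> {}" "\<And>x. x \<in> A \<Longrightarrow> G x = ereal (F x)" "\<And>x. x \<in> A \<Longrightarrow> F x \<le> b"
  shows "\<bar>SUP x\<in>A. G x\<bar> \<noteq> \<infinity>"
proof -
  obtain a where a: "a \<in> A" using assms(1) by auto
  have "ereal (F a) \<le> (SUP x\<in>A. G x)" using SUP_upper[OF a, of G] assms(2)[OF a] by simp
  moreover have "(SUP x\<in>A. G x) \<le> ereal b" by (rule SUP_least) (use assms in auto)
  ultimately show ?thesis by (cases "SUP x\<in>A. G x") auto
qed

context saddle_problem
begin

text \<open>Real-valued versions of the saddle function, the primal function and the dual function. Regularization
weight 0 gives the unregularized functions.\<close>

definition saddle_val :: "real \<Rightarrow> 'a \<Rightarrow> 'b \<Rightarrow> real" where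
  "saddle_val \<rho> x l = real_of_ereal (S_reg (S_fun f g h \<Phi>) \<omega> \<rho> x l)"

definition primal_val :: "real \<Rightarrow> 'a \<Rightarrow> real" where
  "primal_val \<rho> x = real_of_ereal (psi_P \<Lambda> (S_reg (S_fun f g h \<Phi>) \<omega> \<rho>) x)"

definition dual_val :: "'b \<Rightarrow> real" where
  "dual_val l = real_of_ereal (psi_D X (S_fun f g h \<Phi>) l)"

lemma f_finite: "x \<in> X \<Longrightarrow> f x = ereal (real_val f x)"
  using f_diff unfolding ereal_differentiable_on_def by (metis ereal_real' subsetD)

lemma g_finite: "x \<in> X \<Longrightarrow> g x = ereal (real_val g x)"
  using g unfolding convex_closed_proper_def effdom_def by (cases "g x") auto

lemma h_finite: "l \<in> \<Lambda> \<Longrightarrow> h l = ereal (real_val h l)"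
  using h unfolding convex_closed_proper_def effdom_def by (cases "h l") auto

lemma \<omega>_finite: "l \<in> \<Lambda> \<Longrightarrow> \<omega> l = ereal (real_val \<omega> l)"
  using \<omega> unfolding convex_closed_proper_def effdom_def by (cases "\<omega> l") auto

lemma S_reg_eq_formula:
  assumes "x \<in> X" "l \<in> \<Lambda>"
  shows "S_reg (S_fun f g h \<Phi>) \<omega> \<rho> x l
    = ereal (real_val f x + real_val g x + \<Phi> x l - real_val h l - \<rho> * real_val \<omega> l)"
  unfolding S_reg_def S_fun_def
  by (subst f_finite[OF assms(1)], subst g_finite[OF assms(1)], subst h_finite[OF assms(2)],
      subst \<omega>_finite[OF assms(2)]) simp

lemma saddle_val_formula:
  assumes "x \<in> X" "l \<in> \<Lambda>"
  shows "saddle_val \<rho> x l = real_val f x + real_val g x + \<Phi> x l - real_val h l - \<rho> * real_val \<omega> l"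
  unfolding saddle_val_def S_reg_eq_formula[OF assms] by simp

lemma S_reg_eq: "x \<in> X \<Longrightarrow> l \<in> \<Lambda> \<Longrightarrow> S_reg (S_fun f g h \<Phi>) \<omega> \<rho> x l = ereal (saddle_val \<rho> x l)"
  by (simp add: saddle_val_formula S_reg_eq_formula)

lemma S_fun_eq: "x \<in> X \<Longrightarrow> l \<in> \<Lambda> \<Longrightarrow> S_fun f g h \<Phi> x l = ereal (saddle_val 0 x l)"
  using S_reg_eq[of x l 0] by simp

lemma saddle_val_shift: "x \<in> X \<Longrightarrow> l \<in> \<Lambda> \<Longrightarrow> saddle_val \<rho> x l = saddle_val 0 x l - \<rho> * real_val \<omega> l"
  by (simp add: saddle_val_formula)

lemma \<Phi>_continuous_x: "continuous_on UNIV (\<lambda>x. \<Phi> x l)"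
  by (intro differentiable_imp_continuous_on) (simp add: differentiable_on_def \<Phi>_diff_x)

lemma \<Phi>_continuous_l: "continuous_on UNIV (\<lambda>l. \<Phi> x l)"
  by (intro differentiable_imp_continuous_on) (simp add: differentiable_on_def \<Phi>_diff_l)

lemma convex_real_val:
  assumes "convex_closed_proper F" "convex C" "\<And>x. x \<in> C \<Longrightarrow> F x = ereal (real_val F x)"
  shows "sconvex_on 0 C (real_val F)"
  unfolding sconvex_on_def
proof (intro ballI)
  fix x y t assume *: "x \<in> C" "y \<in> C" "t \<in> {0..1::real}"
  let ?z = "(1 - t) *\<^sub>R x + t *\<^sub>R y"
  have "?z \<in> C" using * assms(2) unfolding convex_alt by auto
  then have "ereal (real_val F ?z) = F ?z" using assms(3) by simp
  also have "\<dots> \<le> ereal ((1 - t) * real_val F x + t * real_val F y)"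
    using assms(1) * by (intro convex_epigraphD assms(3)) (auto simp: convex_closed_proper_def)
  finally show "real_val F ?z \<le> (1 - t) * real_val F x + t * real_val F y - 0 / 2 * t * (1 - t) * (norm (x - y))\<^sup>2"
    by simp
qed

text \<open>The lower quadratic bounds at \<open>z = (1 - t) x + t y\<close> for the increments to \<open>x\<close> and to \<open>y\<close> are
averaged with weights \<open>1 - t\<close> and \<open>t\<close>; the gradient terms cancel.\<close>

lemma f_sconvex: "sconvex_on \<mu> X (real_val f)"
  unfolding sconvex_on_def
proof (intro ballI)
  fix x y t assume *: "x \<in> X" "y \<in> X" "t \<in> {0..1::real}"
  define z where "z = (1 - t) *\<^sub>R x + t *\<^sub>R y"
  have z: "z \<in> X" using * X(3) unfolding convex_alt z_def by auto
  let ?A = "blinfun_apply (grad (real_val f) z)"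
  have xz: "x - z = t *\<^sub>R (x - y)" and yz: "y - z = (1 - t) *\<^sub>R (y - x)"
    by (simp_all add: z_def algebra_simps)
  have nx: "norm (x - z) = t * norm (x - y)" and ny: "norm (y - z) = (1 - t) * norm (x - y)"
    unfolding xz yz using * by (simp_all add: norm_minus_commute)
  have "\<mu> / 2 * (t * norm (x - y))\<^sup>2 \<le> real_val f x - real_val f z - t * ?A (x - y)"
    using f_lower[OF *(1) z] unfolding nx unfolding xz by (simp add: blinfun.scaleR_right)
  from mult_left_mono[OF this, of "1 - t"] *(3)
  have 1: "(1 - t) * (\<mu> / 2 * (t * norm (x - y))\<^sup>2) \<le> (1 - t) * (real_val f x - real_val f z - t * ?A (x - y))"
    by simp
  have "?A (y - x) = - ?A (x - y)" by (metis blinfun.minus_right minus_diff_eq)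
  then have "\<mu> / 2 * ((1 - t) * norm (x - y))\<^sup>2 \<le> real_val f y - real_val f z + (1 - t) * ?A (x - y)"
    using f_lower[OF *(2) z] unfolding ny unfolding yz by (simp add: blinfun.scaleR_right)
  from mult_left_mono[OF this, of t] *(3)
  have 2: "t * (\<mu> / 2 * ((1 - t) * norm (x - y))\<^sup>2) \<le> t * (real_val f y - real_val f z + (1 - t) * ?A (x - y))"
    by simp
  have "(1 - t) * (\<mu> / 2 * (t * norm (x - y))\<^sup>2) + t * (\<mu> / 2 * ((1 - t) * norm (x - y))\<^sup>2)
      = \<mu> / 2 * t * (1 - t) * (norm (x - y))\<^sup>2"
    by (simp add: field_simps power2_eq_square)
  moreover have "(1 - t) * (real_val f x - real_val f z - t * ?A (x - y))
      + t * (real_val f y - real_val f z + (1 - t) * ?A (x - y))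
      = (1 - t) * real_val f x + t * real_val f y - real_val f z"
    by (simp add: algebra_simps)
  ultimately show "real_val f ((1 - t) *\<^sub>R x + t *\<^sub>R y)
      \<le> (1 - t) * real_val f x + t * real_val f y - \<mu> / 2 * t * (1 - t) * (norm (x - y))\<^sup>2"
    using 1 2 unfolding z_def[symmetric] by linarith
qed

lemma \<omega>_sconvex: "sconvex_on 1 \<Lambda> (real_val \<omega>)"
  unfolding sconvex_on_def
proof (intro ballI)
  fix x y t assume *: "x \<in> \<Lambda>" "y \<in> \<Lambda>" "t \<in> {0..1::real}"
  let ?z = "(1 - t) *\<^sub>R x + t *\<^sub>R y"
  have z: "?z \<in> \<Lambda>" using * \<Lambda>(3) unfolding convex_alt by auto
  have "\<omega> ?z \<le> ereal (1 - t) * \<omega> x + ereal t * \<omega> y - ereal (1 / 2 * t * (1 - t) * (norm (x - y))\<^sup>2)"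
    using \<omega>_strong * unfolding strongly_convex_on_def by blast
  then show "real_val \<omega> ?z \<le> (1 - t) * real_val \<omega> x + t * real_val \<omega> y - 1 / 2 * t * (1 - t) * (norm (x - y))\<^sup>2"
    by (subst (asm) \<omega>_finite[OF z], subst (asm) \<omega>_finite[OF *(1)], subst (asm) \<omega>_finite[OF *(2)]) simp
qed

lemma saddle_val_sconvex_x:
  assumes "l \<in> \<Lambda>"
  shows "sconvex_on \<mu> X (\<lambda>x. saddle_val \<rho> x l)"
proof -
  have "sconvex_on (\<mu> + 0 + 0 + 0) X
      (\<lambda>x. real_val f x + real_val g x + \<Phi> x l + - (real_val h l + \<rho> * real_val \<omega> l))"
    using \<Phi>_convex[of l]
    by (intro sconvex_on_add f_sconvex convex_real_val[OF g(1) X(3) g_finite] sconvex_on_const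
        sconvex_on_convex) (auto intro: convex_on_subset X(3) \<Lambda>(3))
  then show ?thesis
    by (subst sconvex_on_cong[OF _ X(3)]) (auto simp: saddle_val_formula assms algebra_simps)
qed

lemma saddle_val_sconcave_l:
  assumes "x \<in> X" "\<rho> \<ge> 0"
  shows "sconvex_on \<rho> \<Lambda> (\<lambda>l. - saddle_val \<rho> x l)"
proof -
  have "sconvex_on (\<rho> * 1 + 0 + 0 + 0) \<Lambda>
      (\<lambda>l. \<rho> * real_val \<omega> l + real_val h l + - \<Phi> x l + - (real_val f x + real_val g x))"
    using \<Phi>_concave[of x] assms(2) unfolding concave_on_def
    by (intro sconvex_on_add sconvex_on_cmult \<omega>_sconvex convex_real_val[OF h(1) \<Lambda>(3) h_finite]
        sconvex_on_const sconvex_on_convex) (auto intro: convex_on_subset X(3) \<Lambda>(3))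
  then show ?thesis
    by (subst sconvex_on_cong[OF _ \<Lambda>(3)]) (auto simp: saddle_val_formula assms algebra_simps)
qed

lemma psi_D_finite:
  assumes l: "l \<in> \<Lambda>"
  shows "\<bar>psi_D X (S_fun f g h \<Phi>) l\<bar> \<noteq> \<infinity>"
proof -
  obtain x where x: "x \<in> X" using X(1) by auto
  have "continuous_on UNIV (\<lambda>x. \<Phi> x l - real_val h l)"
    by (intro continuous_intros \<Phi>_continuous_x)
  then obtain r c where r: "r > 0"
    and "\<And>z. z \<in> X \<Longrightarrow> dist x z \<le> r \<Longrightarrow> c \<le> real_val f z + 1 * real_val g z + (\<Phi> z l - real_val h l)"
    using locally_bounded_below_sum[OF f g(1) f_finite g_finite zero_le_one] by blast
  then have "c \<le> saddle_val 0 z l" if "z \<in> X" "dist x z \<le> r" for z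
    using that l by (fastforce simp: saddle_val_formula)
  then obtain b where "\<And>y. y \<in> X \<Longrightarrow> b \<le> saddle_val 0 y l"
    using sconvex_on_bounded_below[OF saddle_val_sconvex_x[OF l] \<mu>_L(1) X(3) x r] by blast
  then show ?thesis
    unfolding psi_D_def
    using finite_INF_ereal[OF X(1), of "\<lambda>x. S_fun f g h \<Phi> x l" "\<lambda>x. saddle_val 0 x l" b] S_fun_eq[OF _ l] by simp
qed

lemma dual_val_ereal: "l \<in> \<Lambda> \<Longrightarrow> psi_D X (S_fun f g h \<Phi>) l = ereal (dual_val l)"
  using psi_D_finite by (simp add: dual_val_def ereal_real')

lemma dual_val_le: "x \<in> X \<Longrightarrow> l \<in> \<Lambda> \<Longrightarrow> dual_val l \<le> saddle_val 0 x l"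
  using INF_lower[of x X "\<lambda>x. S_fun f g h \<Phi> x l"] dual_val_ereal[of l] S_fun_eq[of x l]
  by (simp add: psi_D_def)

lemma dual_val_greatest:
  assumes "l \<in> \<Lambda>" "\<And>x. x \<in> X \<Longrightarrow> b \<le> saddle_val 0 x l"
  shows "b \<le> dual_val l"
  using INF_greatest[of X "ereal b" "\<lambda>x. S_fun f g h \<Phi> x l"] dual_val_ereal[of l] S_fun_eq[of _ l] assms
  by (simp add: psi_D_def)

lemma saddle_val_bounded_above:
  assumes x: "x \<in> X" and \<rho>: "\<rho> > 0"
  obtains b where "\<And>l. l \<in> \<Lambda> \<Longrightarrow> saddle_val \<rho> x l \<le> b"
proof -
  obtain l where l: "l \<in> \<Lambda>" using \<Lambda>(1) by auto
  have "continuous_on UNIV (\<lambda>l. - \<Phi> x l - (real_val f x + real_val g x))"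
    by (intro continuous_intros \<Phi>_continuous_l)
  then obtain r c where r: "r > 0"
    and "\<And>z. z \<in> \<Lambda> \<Longrightarrow> dist l z \<le> r \<Longrightarrow>
      c \<le> real_val h z + \<rho> * real_val \<omega> z + (- \<Phi> x z - (real_val f x + real_val g x))"
    using locally_bounded_below_sum[OF h(1) \<omega>(1) h_finite \<omega>_finite less_imp_le[OF \<rho>]] by blast
  then have "c \<le> - saddle_val \<rho> x z" if "z \<in> \<Lambda>" "dist l z \<le> r" for z
    using that x by (fastforce simp: saddle_val_formula)
  then obtain b where "\<And>y. y \<in> \<Lambda> \<Longrightarrow> b \<le> - saddle_val \<rho> x y"
    using sconvex_on_bounded_below[OF saddle_val_sconcave_l[OF x less_imp_le[OF \<rho>]] \<rho> \<Lambda>(3) l r] by blast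
  then show ?thesis by (intro that[of "- b"]) force
qed

text \<open>The supremum defining the primal function is finite either because \<open>\<rho> > 0\<close> or, for \<open>\<rho> = 0\<close>, because
\<open>\<Lambda>\<close> is bounded. The next lemmas cover both cases by assuming an upper bound.\<close>

lemma psi_P_finite:
  assumes "x \<in> X" "\<And>l. l \<in> \<Lambda> \<Longrightarrow> saddle_val \<rho> x l \<le> b"
  shows "\<bar>psi_P \<Lambda> (S_reg (S_fun f g h \<Phi>) \<omega> \<rho>) x\<bar> \<noteq> \<infinity>"
  unfolding psi_P_def by (rule finite_SUP_ereal[OF \<Lambda>(1) _ assms(2)]) (auto simp: S_reg_eq assms(1))

lemma primal_val_ereal_of_bound:
  assumes "x \<in> X" "\<And>l. l \<in> \<Lambda> \<Longrightarrow> saddle_val \<rho> x l \<le> b"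
  shows "psi_P \<Lambda> (S_reg (S_fun f g h \<Phi>) \<omega> \<rho>) x = ereal (primal_val \<rho> x)"
  using psi_P_finite[OF assms] by (simp add: primal_val_def ereal_real')

lemma primal_val_le:
  assumes "x \<in> X" "\<And>l. l \<in> \<Lambda> \<Longrightarrow> saddle_val \<rho> x l \<le> b"
  shows "primal_val \<rho> x \<le> b"
  using SUP_least[of \<Lambda> "\<lambda>l. S_reg (S_fun f g h \<Phi>) \<omega> \<rho> x l" "ereal b"] assms(2)
    S_reg_eq[OF assms(1)] primal_val_ereal_of_bound[OF assms]
  by (simp add: psi_P_def)

lemma saddle_val_le_primal_val_of_bound:
  assumes "x \<in> X" "\<And>l. l \<in> \<Lambda> \<Longrightarrow> saddle_val \<rho> x l \<le> b" "l \<in> \<Lambda>"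
  shows "saddle_val \<rho> x l \<le> primal_val \<rho> x"
  using SUP_upper[OF assms(3), of "\<lambda>l. S_reg (S_fun f g h \<Phi>) \<omega> \<rho> x l"]
    primal_val_ereal_of_bound[OF assms(1,2)] S_reg_eq[OF assms(1,3)]
  by (simp add: psi_P_def)

lemma primal_val_ereal:
  assumes "x \<in> X" "\<rho> > 0"
  shows "psi_P \<Lambda> (S_reg (S_fun f g h \<Phi>) \<omega> \<rho>) x = ereal (primal_val \<rho> x)"
  using saddle_val_bounded_above[OF assms] primal_val_ereal_of_bound[OF assms(1)] by metis

lemma saddle_val_le_primal_val:
  assumes "x \<in> X" "\<rho> > 0" "l \<in> \<Lambda>"
  shows "saddle_val \<rho> x l \<le> primal_val \<rho> x"
  using saddle_val_bounded_above[OF assms(1,2)] saddle_val_le_primal_val_of_bound[OF assms(1) _ assms(3)] by metis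

text \<open>At a saddle point \<open>(xs, ls)\<close> one has \<open>D l \<le> S xs l \<le> S xs ls \<le> S x ls\<close>. This yields the lower
bounds on the gaps that integrability needs.\<close>

lemma saddle_dual_bound:
  "\<exists>ls\<in>\<Lambda>. \<forall>x\<in>X. \<forall>l\<in>\<Lambda>. dual_val l \<le> saddle_val 0 x ls"
proof -
  obtain xs ls where s: "xs \<in> X" "ls \<in> \<Lambda>"
    and sad: "\<And>x l. x \<in> X \<Longrightarrow> l \<in> \<Lambda> \<Longrightarrow> saddle_val 0 xs l \<le> saddle_val 0 xs ls \<and> saddle_val 0 xs ls \<le> saddle_val 0 x ls"
    using saddle by (auto simp: S_fun_eq)
  show ?thesis
  proof (intro bexI[OF _ s(2)] ballI)
    fix x l assume "x \<in> X" "l \<in> \<Lambda>"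
    then show "dual_val l \<le> saddle_val 0 x ls" using dual_val_le[OF s(1), of l] sad[of x l] by linarith
  qed
qed

section \<open>One iteration\<close>

lemma \<Phi>_supergradient:
  "\<Phi> x l' \<le> \<Phi> x l + blinfun_apply (grad (\<lambda>l. \<Phi> x l) l) (l' - l)"
  by (rule concave_on_gradient[OF \<Phi>_concave \<Phi>_diff_l])

text \<open>The dual function behaves like a smooth function with constant \<open>L\<^sub>D\<close> of which only an approximate
gradient is known, namely the gradient of \<open>\<Phi> y\<close> at an approximate minimizer \<open>y\<close>. For any
competitor \<open>x\<close>, replacing the gradient at \<open>x\<close> by the one at \<open>y\<close> costs at most
\<open>L\<^sub>l\<^sub>x |x - y| |l' - l|\<close>, and by the midpoint estimate \<open>\<mu> |x - y|\<^sup>2 / 4\<close> is at most the sum of the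
two optimality errors. Young's inequality then cancels the error of \<open>x\<close> exactly and
leaves twice the error of \<open>y\<close>.\<close>

lemma inexact_oracle:
  assumes y: "y \<in> X" and l: "l \<in> \<Lambda>" "l' \<in> \<Lambda>"
  shows "saddle_val 0 y l + real_val h l - real_val h l' + blinfun_apply (grad (\<lambda>l. \<Phi> y l) l) (l' - l)
    - 2 * (saddle_val 0 y l - dual_val l) - (L\<^sub>l\<^sub>l + L\<^sub>l\<^sub>x\<^sup>2 / \<mu>) * (norm (l' - l))\<^sup>2 \<le> dual_val l'"
proof (rule dual_val_greatest[OF l(2)])
  fix x assume x: "x \<in> X"
  let ?G = "\<lambda>x l. grad (\<lambda>l. \<Phi> x l) l"
  define u where "u = l' - l"
  define d where "d = norm (x - y)"
  define e where "e = norm u"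
  have "\<bar>(?G x l - ?G x l') u\<bar> \<le> norm (?G x l - ?G x l') * e"
    unfolding e_def by (metis norm_blinfun real_norm_def)
  also have "\<dots> \<le> L\<^sub>l\<^sub>l * e * e"
    using \<Phi>_ll[OF x l] unfolding e_def u_def by (intro mult_right_mono) (simp_all add: norm_minus_commute)
  finally have 1: "\<bar>?G x l u - ?G x l' u\<bar> \<le> L\<^sub>l\<^sub>l * e\<^sup>2"
    by (simp add: blinfun.diff_left power2_eq_square)
  have "\<bar>(?G x l - ?G y l) u\<bar> \<le> norm (?G x l - ?G y l) * e"
    unfolding e_def by (metis norm_blinfun real_norm_def)
  also have "\<dots> \<le> L\<^sub>l\<^sub>x * d * e"
    using \<Phi>_lx[OF x y l(1)] unfolding e_def d_def by (intro mult_right_mono) simp_all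
  finally have 2: "\<bar>?G x l u - ?G y l u\<bar> \<le> L\<^sub>l\<^sub>x * d * e"
    by (simp add: blinfun.diff_left)
  have 3: "\<mu> / 4 * d\<^sup>2 \<le> (saddle_val 0 x l - dual_val l) + (saddle_val 0 y l - dual_val l)"
    unfolding d_def using sconvex_on_midpoint[OF saddle_val_sconvex_x[OF l(1)] X(3) _ x y, where c = "dual_val l"] dual_val_le l(1) by blast
  have "\<mu> / 4 * d\<^sup>2 + L\<^sub>l\<^sub>x\<^sup>2 / \<mu> * e\<^sup>2 - L\<^sub>l\<^sub>x * d * e = \<mu> * (d / 2 - L\<^sub>l\<^sub>x / \<mu> * e)\<^sup>2"
    using \<mu>_L(1) by (simp add: field_simps power2_eq_square)
  moreover have "\<mu> * (d / 2 - L\<^sub>l\<^sub>x / \<mu> * e)\<^sup>2 \<ge> 0" using \<mu>_L(1) by simp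
  ultimately have 4: "L\<^sub>l\<^sub>x * d * e \<le> \<mu> / 4 * d\<^sup>2 + L\<^sub>l\<^sub>x\<^sup>2 / \<mu> * e\<^sup>2" by linarith
  \<comment> \<open>Concavity is used at \<open>l'\<close>, not at \<open>l\<close>, since a lower bound of the increment is needed.\<close>
  have "?G x l' (l - l') = - ?G x l' u"
    unfolding u_def by (metis blinfun.minus_right minus_diff_eq)
  then have 5: "\<Phi> x l + ?G x l' u \<le> \<Phi> x l'"
    using \<Phi>_supergradient[of x l l'] by simp
  have 6: "saddle_val 0 x l' = saddle_val 0 x l + real_val h l - real_val h l' + (\<Phi> x l' - \<Phi> x l)"
    using x l by (simp add: saddle_val_formula)
  have 7: "(L\<^sub>l\<^sub>l + L\<^sub>l\<^sub>x\<^sup>2 / \<mu>) * e\<^sup>2 = L\<^sub>l\<^sub>l * e\<^sup>2 + L\<^sub>l\<^sub>x\<^sup>2 / \<mu> * e\<^sup>2"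
    by (rule distrib_right)
  define A where "A = L\<^sub>l\<^sub>l * e\<^sup>2"
  define B where "B = L\<^sub>l\<^sub>x\<^sup>2 / \<mu> * e\<^sup>2"
  define C where "C = L\<^sub>l\<^sub>x * d * e"
  define p where "p = blinfun_apply (?G x l) u"
  define q where "q = blinfun_apply (?G x l') u"
  define s where "s = blinfun_apply (?G y l) u"
  show "saddle_val 0 y l + real_val h l - real_val h l' + blinfun_apply (?G y l) (l' - l)
    - 2 * (saddle_val 0 y l - dual_val l) - (L\<^sub>l\<^sub>l + L\<^sub>l\<^sub>x\<^sup>2 / \<mu>) * (norm (l' - l))\<^sup>2 \<le> saddle_val 0 x l'"
  proof -
    have "p - q \<le> A" "s - p \<le> C"
      using abs_le_D1[OF 1] abs_le_D2[OF 2] by (simp_all add: p_def q_def s_def A_def C_def)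
    then have "s - C - A \<le> q" by linarith
    moreover have "C \<le> \<mu> / 4 * d\<^sup>2 + B" using 4 by (simp add: B_def C_def)
    then have "C \<le> (saddle_val 0 x l - dual_val l) + (saddle_val 0 y l - dual_val l) + B" using 3 by linarith
    moreover have "q \<le> \<Phi> x l' - \<Phi> x l" using 5 by (simp add: q_def)
    ultimately have "saddle_val 0 y l + s - 2 * (saddle_val 0 y l - dual_val l) - (A + B) \<le> saddle_val 0 x l + (\<Phi> x l' - \<Phi> x l)"
      by argo
    then show ?thesis
      unfolding u_def[symmetric] e_def[symmetric] 7 6 A_def[symmetric] B_def[symmetric] s_def[symmetric]
      by linarith
  qed
qed

text \<open>The deterministic core of the convergence proof: \<open>a\<close> and \<open>b\<close> are the outputs of the two
dual calls, \<open>y\<close> is the output of the primal call at \<open>m\<close>. Since \<open>l' - m = (1 - \<tau>) (b - a)\<close>, the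
quadratic error of the oracle involves only \<open>|a - b|\<close>, which strong concavity of the
regularized function controls, even when \<open>\<Lambda>\<close> is unbounded. Adding the optimality error of \<open>b\<close> to both
sides turns the left-hand side into the next gap.\<close>

lemma one_step:
  assumes x: "x \<in> X" and y: "y \<in> X" and l: "l \<in> \<Lambda>" and a: "a \<in> \<Lambda>" and b: "b \<in> \<Lambda>"
    and \<tau>: "0 \<le> \<tau>" "\<tau> \<le> 1" and \<rho>: "\<rho> > 0" "4 * (L\<^sub>l\<^sub>l + L\<^sub>l\<^sub>x\<^sup>2 / \<mu>) * (1 - \<tau>)\<^sup>2 \<le> \<tau> * \<rho>"
    and m: "m = \<tau> *\<^sub>R l + (1 - \<tau>) *\<^sub>R a"
    and x': "x' = \<tau> *\<^sub>R x + (1 - \<tau>) *\<^sub>R y"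
    and l': "l' = \<tau> *\<^sub>R l + (1 - \<tau>) *\<^sub>R b"
  shows "saddle_val (\<tau> * \<rho>) x' b - dual_val l'
    \<le> \<tau> * (primal_val \<rho> x - dual_val l) + \<tau> * (primal_val \<rho> x - saddle_val \<rho> x a) + 2 * (saddle_val 0 y m - dual_val m)"
proof -
  let ?L = "L\<^sub>l\<^sub>l + L\<^sub>l\<^sub>x\<^sup>2 / \<mu>"
  define N where "N = (norm (a - b))\<^sup>2"
  have xX: "x' \<in> X" and mL: "m \<in> \<Lambda>" and lL: "l' \<in> \<Lambda>"
    using convexD[OF X(3) x y \<tau>(1), of "1 - \<tau>"] convexD[OF \<Lambda>(3) l a \<tau>(1), of "1 - \<tau>"]
      convexD[OF \<Lambda>(3) l b \<tau>(1), of "1 - \<tau>"] \<tau> by (auto simp: x' m l')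
  \<comment> \<open>Up to the term in \<open>h\<close>, \<open>Q\<close> is the linearization of the saddle function at \<open>m\<close>. It bounds the values at \<open>b\<close> and
    \<open>l\<close> from above, and being affine it distributes over the convex combination \<open>l'\<close>.\<close>
  define Q where "Q = (\<lambda>v. saddle_val 0 y m + real_val h m + blinfun_apply (grad (\<lambda>l. \<Phi> y l) m) (v - m))"
  have Q: "saddle_val 0 y v \<le> Q v - real_val h v" if "v \<in> \<Lambda>" for v
    using \<Phi>_supergradient[of y v m] y mL that by (simp add: Q_def saddle_val_formula)
  have lm: "l' - m = \<tau> *\<^sub>R (l - m) + (1 - \<tau>) *\<^sub>R (b - m)"
    by (simp add: l' algebra_simps)
  have Ql: "Q l' = \<tau> * Q l + (1 - \<tau>) * Q b"
    unfolding Q_def lm blinfun.add_right blinfun.scaleR_right by (simp add: algebra_simps)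
  have "l' - m = (1 - \<tau>) *\<^sub>R (b - a)" by (simp add: l' m algebra_simps)
  then have "norm (l' - m) = (1 - \<tau>) * norm (a - b)" using \<tau> by (simp add: norm_minus_commute)
  then have nl: "(norm (l' - m))\<^sup>2 = (1 - \<tau>)\<^sup>2 * N" by (simp add: N_def power_mult_distrib)
  have "sconvex_on 0 \<Lambda> (real_val h)" by (rule convex_real_val[OF h(1) \<Lambda>(3) h_finite])
  from sconvex_onD[OF this l b, of "1 - \<tau>"] \<tau>
  have hl: "real_val h l' \<le> \<tau> * real_val h l + (1 - \<tau>) * real_val h b" by (simp add: l')
  have "Q l' - real_val h l' - 2 * (saddle_val 0 y m - dual_val m) - ?L * ((1 - \<tau>)\<^sup>2 * N) \<le> dual_val l'"
    using inexact_oracle[OF y mL lL] unfolding nl Q_def by linarith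
  then have D1: "\<tau> * (Q l - real_val h l) + (1 - \<tau>) * (Q b - real_val h b)
      - 2 * (saddle_val 0 y m - dual_val m) - ?L * ((1 - \<tau>)\<^sup>2 * N) \<le> dual_val l'"
    using hl Ql unfolding right_diff_distrib by linarith
  have D2: "\<tau> * dual_val l \<le> \<tau> * (Q l - real_val h l)"
    using dual_val_le[OF y l] Q[OF l] \<tau> by (intro mult_left_mono) auto
  have D3: "(1 - \<tau>) * saddle_val 0 y b \<le> (1 - \<tau>) * (Q b - real_val h b)"
    using Q[OF b] \<tau> by (intro mult_left_mono) auto
  from sconvex_onD[OF saddle_val_sconvex_x[OF b] x y, of "1 - \<tau>" 0] \<tau>
  have "saddle_val 0 x' b \<le> \<tau> * saddle_val 0 x b + (1 - \<tau>) * saddle_val 0 y b - \<mu> / 2 * (1 - \<tau>) * \<tau> * (norm (x - y))\<^sup>2"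
    by (simp add: x')
  moreover have "\<mu> / 2 * (1 - \<tau>) * \<tau> * (norm (x - y))\<^sup>2 \<ge> 0" using \<tau> \<mu>_L by simp
  ultimately have "saddle_val 0 x' b \<le> \<tau> * saddle_val 0 x b + (1 - \<tau>) * saddle_val 0 y b" by linarith
  then have P1: "saddle_val (\<tau> * \<rho>) x' b \<le> \<tau> * saddle_val \<rho> x b + (1 - \<tau>) * saddle_val 0 y b"
    unfolding saddle_val_shift[OF xX b, of "\<tau> * \<rho>"] saddle_val_shift[OF x b, of \<rho>] by (simp add: algebra_simps)
  \<comment> \<open>The squared distance of \<open>a\<close> and \<open>b\<close> is bounded by the sum of their optimality errors. Solved for the
    value at \<open>b\<close>, this yields a negative quadratic term at the price of the error of \<open>a\<close>.\<close>
  have "\<rho> / 4 * N \<le> (- saddle_val \<rho> x a - (- primal_val \<rho> x)) + (- saddle_val \<rho> x b - (- primal_val \<rho> x))"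
    unfolding N_def using saddle_val_le_primal_val[OF x \<rho>(1)] \<rho>(1)
    by (intro sconvex_on_midpoint[OF saddle_val_sconcave_l[OF x] \<Lambda>(3) _ a b]) auto
  from mult_left_mono[OF this \<tau>(1)]
  have P2: "\<tau> * \<rho> / 4 * N \<le> 2 * (\<tau> * primal_val \<rho> x) - \<tau> * saddle_val \<rho> x a - \<tau> * saddle_val \<rho> x b"
    by (simp add: algebra_simps)
  \<comment> \<open>The hypothesis on \<open>\<tau> * \<rho>\<close> lets strong concavity absorb the quadratic error of the oracle.\<close>
  define W where "W = ?L * ((1 - \<tau>)\<^sup>2 * N)"
  have "4 * ?L * (1 - \<tau>)\<^sup>2 * N \<le> \<tau> * \<rho> * N"
    using \<rho>(2) by (intro mult_right_mono) (auto simp: N_def)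
  then have "4 * W \<le> \<tau> * \<rho> * N" unfolding W_def by (simp only: mult.assoc)
  then have P3: "W \<le> \<tau> * \<rho> / 4 * N" by simp
  show ?thesis
    using D1[folded W_def] D2 D3 P1 P2 P3 unfolding right_diff_distrib by linarith
qed

section \<open>Measurability of the values\<close>

text \<open>For fixed second variable the regularized saddle function is lower semicontinuous in the first one, and so is the
supremum.\<close>

lemma psi_P_borel: "psi_P \<Lambda> (S_reg (S_fun f g h \<Phi>) \<omega> \<rho>) \<in> borel_measurable borel"
proof (rule borel_measurable_lsc)
  fix c
  have fg: "f x \<noteq> - \<infinity>" "g x \<noteq> - \<infinity>" for x
    using f g unfolding convex_closed_proper_def by auto
  have "closed {x. S_reg (S_fun f g h \<Phi>) \<omega> \<rho> x l \<le> ereal c}" if l: "l \<in> \<Lambda>" for l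
  proof -
    let ?p = "\<lambda>x. \<Phi> x l - (real_val h l + \<rho> * real_val \<omega> l)"
    have "S_reg (S_fun f g h \<Phi>) \<omega> \<rho> x l = f x + (g x + ereal (?p x))" for x
      unfolding S_reg_def S_fun_def
      by (subst h_finite[OF l], subst \<omega>_finite[OF l], cases "f x"; cases "g x") (use fg[of x] in auto)
    moreover have "continuous_on UNIV ?p"
      by (intro continuous_intros \<Phi>_continuous_x)
    then have "closed {x. f x + (g x + ereal (?p x)) \<le> ereal c}"
      using fg f g by (intro closed_sublevel_add closed_sublevel closed_sublevel_continuous)
         (auto simp: convex_closed_proper_def)
    ultimately show ?thesis by simp
  qed
  then show "closed {x. psi_P \<Lambda> (S_reg (S_fun f g h \<Phi>) \<omega> \<rho>) x \<le> ereal c}"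
    unfolding psi_P_def by (rule closed_sublevel_SUP)
qed

lemma psi_D_borel: "psi_D X (S_fun f g h \<Phi>) \<in> borel_measurable borel"
proof -
  have hm: "h l \<noteq> - \<infinity>" for l
    using h unfolding convex_closed_proper_def by auto
  have "(\<lambda>l. - psi_D X (S_fun f g h \<Phi>) l) \<in> borel_measurable borel"
  proof (rule borel_measurable_lsc)
    fix c
    have "closed {l. - S_fun f g h \<Phi> x l \<le> ereal c}" if x: "x \<in> X" for x
    proof -
      let ?p = "\<lambda>l. - (real_val f x + real_val g x + \<Phi> x l)"
      have "- S_fun f g h \<Phi> x l = h l + ereal (?p l)" for l
        unfolding S_fun_def
        by (subst f_finite[OF x], subst g_finite[OF x], cases "h l") (use hm[of l] in auto)
      moreover have "continuous_on UNIV ?p"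
        by (intro continuous_intros \<Phi>_continuous_l)
      then have "closed {l. h l + ereal (?p l) \<le> ereal c}"
        using hm h by (intro closed_sublevel_add closed_sublevel closed_sublevel_continuous)
           (auto simp: convex_closed_proper_def)
      ultimately show ?thesis by simp
    qed
    then have "closed {l. (SUP x\<in>X. - S_fun f g h \<Phi> x l) \<le> ereal c}"
      by (rule closed_sublevel_SUP)
    then show "closed {l. - psi_D X (S_fun f g h \<Phi>) l \<le> ereal c}"
      unfolding psi_D_def by (simp add: ereal_SUP_uminus_eq)
  qed
  then show ?thesis by (subst (asm) borel_measurable_uminus_eq_ereal)
qed

text \<open>Continuity in each variable separately is not enough. The Lipschitz bounds on the gradient in the second
variable make \<open>\<Phi> x\<close> Lipschitz near \<open>l0\<close> with a constant that is uniform for \<open>x\<close> near \<open>x0\<close>.\<close>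

lemma \<Phi>_jointly_continuous: "continuous_on (X \<times> \<Lambda>) (\<lambda>(x, l). \<Phi> x l)"
  unfolding continuous_on_def
proof (clarify)
  fix x0 l0 assume x0: "x0 \<in> X" and l0: "l0 \<in> \<Lambda>"
  let ?F = "at (x0, l0) within X \<times> \<Lambda>"
  let ?G = "\<lambda>x l. grad (\<lambda>l. \<Phi> x l) l"
  let ?b = "\<lambda>(x, l). (norm (?G x0 l0) + L\<^sub>l\<^sub>x * norm (x - x0) + \<bar>L\<^sub>l\<^sub>l\<bar> * norm (l - l0)) * norm (l - l0)
    + \<bar>\<Phi> x l0 - \<Phi> x0 l0\<bar>"
  have bound: "\<bar>\<Phi> x l - \<Phi> x0 l0\<bar> \<le> ?b (x, l)" if x: "x \<in> X" and l: "l \<in> \<Lambda>" for x l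
  proof -
    define e where "e = norm (l - l0)"
    have n1: "norm (?G x l0) \<le> norm (?G x0 l0) + L\<^sub>l\<^sub>x * norm (x - x0)"
      using \<Phi>_lx[OF x x0 l0] norm_triangle_ineq2[of "?G x l0" "?G x0 l0"] by linarith
    have "L\<^sub>l\<^sub>l * e \<le> \<bar>L\<^sub>l\<^sub>l\<bar> * e" unfolding e_def by (intro mult_right_mono) auto
    then have n2: "norm (?G x l) \<le> norm (?G x l0) + \<bar>L\<^sub>l\<^sub>l\<bar> * e"
      using \<Phi>_ll[OF x l l0] norm_triangle_ineq2[of "?G x l" "?G x l0"] unfolding e_def by linarith
    have n3: "0 \<le> \<bar>L\<^sub>l\<^sub>l\<bar> * e" unfolding e_def by simp
    let ?c = "norm (?G x0 l0) + L\<^sub>l\<^sub>x * norm (x - x0) + \<bar>L\<^sub>l\<^sub>l\<bar> * e"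
    have "\<Phi> x l - \<Phi> x l0 \<le> ?G x l0 (l - l0)" using \<Phi>_supergradient[of x l l0] by simp
    also have "\<dots> \<le> norm (?G x l0) * e" unfolding e_def by (metis norm_blinfun real_norm_def abs_le_D1)
    also have "\<dots> \<le> ?c * e" using n1 n3 by (intro mult_right_mono) (linarith, simp add: e_def)
    finally have 1: "\<Phi> x l - \<Phi> x l0 \<le> ?c * e" .
    have "\<Phi> x l0 - \<Phi> x l \<le> ?G x l (l0 - l)" using \<Phi>_supergradient[of x l0 l] by simp
    also have "\<dots> \<le> norm (?G x l) * e"
      unfolding e_def by (metis norm_blinfun real_norm_def abs_le_D1 norm_minus_commute)
    also have "\<dots> \<le> ?c * e" using n1 n2 by (intro mult_right_mono) (linarith, simp add: e_def)
    finally have 2: "\<Phi> x l0 - \<Phi> x l \<le> ?c * e" .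
    show ?thesis unfolding split e_def[symmetric] using 1 2 by linarith
  qed
  have "isCont (\<lambda>x. \<Phi> x l0) x0"
    using \<Phi>_continuous_x continuous_on_eq_continuous_at open_UNIV by blast
  moreover have f1: "(fst \<longlongrightarrow> x0) ?F" and f2: "(snd \<longlongrightarrow> l0) ?F"
    using tendsto_fst[OF tendsto_ident_at, of "(x0, l0)"] tendsto_snd[OF tendsto_ident_at, of "(x0, l0)"] by simp_all
  ultimately have f3: "((\<lambda>z. \<Phi> (fst z) l0) \<longlongrightarrow> \<Phi> x0 l0) ?F"
    by (intro isCont_tendsto_compose[of x0 "\<lambda>x. \<Phi> x l0"])
  \<comment> \<open>The factor \<open>norm (l - l0)\<close> makes the first summand vanish in the limit.\<close>
  have "(?b \<longlongrightarrow> (norm (?G x0 l0) + L\<^sub>l\<^sub>x * norm (x0 - x0) + \<bar>L\<^sub>l\<^sub>l\<bar> * norm (l0 - l0)) * norm (l0 - l0)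
    + \<bar>\<Phi> x0 l0 - \<Phi> x0 l0\<bar>) ?F"
    unfolding case_prod_beta by (intro tendsto_intros f1 f2 f3)
  then have "(?b \<longlongrightarrow> 0) ?F" by simp
  then have "((\<lambda>z. (\<lambda>(x, l). \<Phi> x l) z - \<Phi> x0 l0) \<longlongrightarrow> 0) ?F"
  proof (rule Lim_null_comparison[rotated])
    show "\<forall>\<^sub>F z in ?F. norm ((\<lambda>(x, l). \<Phi> x l) z - \<Phi> x0 l0) \<le> ?b z"
      unfolding eventually_at_topological using bound by (auto intro!: exI[of _ UNIV])
  qed
  then show "((\<lambda>(x, l). \<Phi> x l) \<longlongrightarrow> \<Phi> x0 l0) ?F"
    by (rule LIM_zero_cancel)
qed

lemma measurable_primal_val:
  assumes "u \<in> borel_measurable N"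
  shows "(\<lambda>w. primal_val \<rho> (u w)) \<in> borel_measurable N"
  unfolding primal_val_def using measurable_compose[OF assms psi_P_borel] by (rule borel_measurable_real_of_ereal)

lemma measurable_dual_val:
  assumes "u \<in> borel_measurable N"
  shows "(\<lambda>w. dual_val (u w)) \<in> borel_measurable N"
  unfolding dual_val_def using measurable_compose[OF assms psi_D_borel] by (rule borel_measurable_real_of_ereal)

lemma measurable_saddle_val:
  assumes u: "u \<in> borel_measurable N" "\<And>w. w \<in> space N \<Longrightarrow> u w \<in> X"
    and v: "v \<in> borel_measurable N" "\<And>w. w \<in> space N \<Longrightarrow> v w \<in> \<Lambda>"
  shows "(\<lambda>w. saddle_val \<rho> (u w) (v w)) \<in> borel_measurable N"
proof -
  note [measurable] = measurable_compose[OF u(1) closed_proper_borel[OF f]]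
    measurable_compose[OF u(1) closed_proper_borel[OF g(1)]]
    measurable_compose[OF v(1) closed_proper_borel[OF h(1)]]
    measurable_compose[OF v(1) closed_proper_borel[OF \<omega>(1)]]
  have "(\<lambda>w. (u w, v w)) \<in> measurable N (restrict_space borel (X \<times> \<Lambda>))"
    using u v by (intro measurable_restrict_space2) auto
  from measurable_compose[OF this borel_measurable_continuous_on_restrict[OF \<Phi>_jointly_continuous]]
  have [measurable]: "(\<lambda>w. \<Phi> (u w) (v w)) \<in> borel_measurable N" by simp
  have "(\<lambda>w. real_val f (u w) + real_val g (u w) + \<Phi> (u w) (v w) - real_val h (v w)
      - \<rho> * real_val \<omega> (v w)) \<in> borel_measurable N"
    by measurable
  then show ?thesis
    by (subst measurable_cong[where g = "\<lambda>w. real_val f (u w) + real_val g (u w) + \<Phi> (u w) (v w)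
        - real_val h (v w) - \<rho> * real_val \<omega> (v w)"]) (auto simp: saddle_val_formula u v)
qed

section \<open>Regularized and plain gap\<close>

lemma gap_reg_eq:
  assumes "x \<in> X" "l \<in> \<Lambda>" "r > 0"
  shows "gap_reg X \<Lambda> (S_fun f g h \<Phi>) \<omega> r x l = ereal (primal_val r x - dual_val l)"
  by (simp add: gap_reg_def primal_val_ereal dual_val_ereal assms)

lemma \<omega>_bounded:
  assumes "bounded \<Lambda>"
  shows "bdd_above ((\<lambda>y. \<bar>real_val \<omega> y\<bar>) ` \<Lambda>)"
proof -
  have "compact \<Lambda>" using assms \<Lambda>(2) compact_eq_bounded_closed by blast
  then obtain a b where ab: "a \<in> \<Lambda>" "b \<in> \<Lambda>" "\<And>y. y \<in> \<Lambda> \<Longrightarrow> \<omega> a \<le> \<omega> y" "\<And>y. y \<in> \<Lambda> \<Longrightarrow> \<omega> y \<le> \<omega> b"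
    using continuous_attains_inf[OF _ \<Lambda>(1) \<omega>(3)] continuous_attains_sup[OF _ \<Lambda>(1) \<omega>(3)] by metis
  have "\<bar>real_val \<omega> y\<bar> \<le> max \<bar>real_val \<omega> a\<bar> \<bar>real_val \<omega> b\<bar>" if "y \<in> \<Lambda>" for y
  proof -
    have "real_val \<omega> a \<le> real_val \<omega> y" "real_val \<omega> y \<le> real_val \<omega> b"
      using ab(3,4)[OF that] \<omega>_finite[OF that] \<omega>_finite[OF ab(1)] \<omega>_finite[OF ab(2)]
      by (metis ereal_less_eq(3))+
    then show ?thesis by linarith
  qed
  then show ?thesis by (intro bdd_aboveI) auto
qed

text \<open>On \<open>\<Lambda>\<close> the two saddle functions differ by at most \<open>r * B\<close>, and so do their suprema.\<close>

lemma unregularized_gap: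
  assumes bd: "bounded \<Lambda>" and x: "x \<in> X" and r: "r > 0"
  defines "B \<equiv> SUP y\<in>\<Lambda>. \<bar>real_val \<omega> y\<bar>"
  shows "psi_P \<Lambda> (S_fun f g h \<Phi>) x = ereal (primal_val 0 x)"
    and "l \<in> \<Lambda> \<Longrightarrow> saddle_val 0 x l \<le> primal_val 0 x"
    and "primal_val 0 x \<le> primal_val r x + r * B"
    and "primal_val r x \<le> primal_val 0 x + r * B"
proof -
  have B: "\<bar>real_val \<omega> l\<bar> \<le> B" if "l \<in> \<Lambda>" for l
    unfolding B_def by (rule cSUP_upper[OF that \<omega>_bounded[OF bd]])
  have rB: "\<bar>r * real_val \<omega> l\<bar> \<le> r * B" if "l \<in> \<Lambda>" for l
    using B[OF that] r by (simp add: abs_mult)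
  have up: "saddle_val 0 x l \<le> primal_val r x + r * B" if "l \<in> \<Lambda>" for l
    using saddle_val_le_primal_val[OF x r that] saddle_val_shift[OF x that, of r] rB[OF that] by linarith
  show "psi_P \<Lambda> (S_fun f g h \<Phi>) x = ereal (primal_val 0 x)"
    using primal_val_ereal_of_bound[OF x up] by simp
  show le: "saddle_val 0 x l \<le> primal_val 0 x" if "l \<in> \<Lambda>" for l
    by (rule saddle_val_le_primal_val_of_bound[OF x up that])
  show "primal_val 0 x \<le> primal_val r x + r * B" by (rule primal_val_le[OF x up])
  show "primal_val r x \<le> primal_val 0 x + r * B"
  proof (rule primal_val_le[OF x])
    fix l assume l: "l \<in> \<Lambda>"
    show "saddle_val r x l \<le> primal_val 0 x + r * B"
      using le[OF l] saddle_val_shift[OF x l, of r] rB[OF l] by linarith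
  qed
qed

end

section \<open>The expected gap of the randomized algorithm\<close>

context randomized_IPDS
begin

lemma \<tau>_bounds: "0 < \<tau> k" "\<tau> k < 1"
  using inputs(4)[of k] by auto

lemma \<rho>_pos: "\<rho> k > 0"
  by (induction k) (simp_all add: inputs(1) step5 \<tau>_bounds)

lemma convex_mix:
  assumes "convex C" "a \<in> C" "b \<in> C"
  shows "\<tau> k *\<^sub>R a + (1 - \<tau> k) *\<^sub>R b \<in> C"
  using convexD[OF assms, of "\<tau> k" "1 - \<tau> k"] \<tau>_bounds[of k] by simp

lemma x_in: "w \<in> space M \<Longrightarrow> x k w \<in> X"
  by (induction k) (simp_all add: start step4 convex_mix X(3) feasible)

lemma l_in: "w \<in> space M \<Longrightarrow> l k w \<in> \<Lambda>"
  by (induction k) (simp_all add: start step7 convex_mix \<Lambda>(3) feasible)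

lemma lhat_in: "w \<in> space M \<Longrightarrow> lhat k w \<in> \<Lambda>"
  by (simp add: step2 convex_mix \<Lambda>(3) feasible l_in)

lemma x_measurable [measurable]: "x k \<in> borel_measurable M"
proof (induction k)
  case 0
  have "x 0 = (\<lambda>_. x0)" using start(3) by auto
  then show ?case by simp
next
  case (Suc k)
  have "x (Suc k) = (\<lambda>w. \<tau> k *\<^sub>R x k w + (1 - \<tau> k) *\<^sub>R xt k w)" using step4 by auto
  then show ?case using Suc random by simp
qed

lemma l_measurable [measurable]: "l k \<in> borel_measurable M"
proof (induction k)
  case 0
  have "l 0 = (\<lambda>_. l0)" using start(4) by auto
  then show ?case by simp
next
  case (Suc k)
  have "l (Suc k) = (\<lambda>w. \<tau> k *\<^sub>R l k w + (1 - \<tau> k) *\<^sub>R lt' k w)" using step7 by auto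
  then show ?case using Suc random by simp
qed

lemma lhat_measurable [measurable]: "lhat k \<in> borel_measurable M"
proof -
  have "lhat k = (\<lambda>w. \<tau> k *\<^sub>R l k w + (1 - \<tau> k) *\<^sub>R lt k w)" using step2 by auto
  then show ?thesis using l_measurable random by simp
qed

lemma subalgebra_filt0: "subalgebra M (filt0 M lt xt lt' k)"
proof (induction k)
  case 0
  then show ?case by (auto simp: subalgebra_def sigma_sets_empty_eq)
next
  case (Suc k)
  then show ?case by (simp add: subalgebra_adjoin random)
qed

lemma subalgebra_filt1: "subalgebra M (filt1 M lt xt lt' k)"
  unfolding filt1_def by (intro subalgebra_adjoin subalgebra_filt0 random)

lemma subalgebra_filt2: "subalgebra M (filt2 M lt xt lt' k)"
  unfolding filt2_def by (intro subalgebra_adjoin subalgebra_filt1 random)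

text \<open>Both dual calls of an iteration are instances: the first one with \<open>j = k\<close>, the second one
with \<open>j = Suc k\<close>.\<close>

lemma dual_error:
  assumes "subalgebra M F" and y: "y \<in> borel_measurable M" "\<And>w. w \<in> space M \<Longrightarrow> y w \<in> \<Lambda>"
    and "0 \<le> c"
    and "AE w in M. nn_cond_exp M F
        (\<lambda>w. e2ennreal (psi_P \<Lambda> (S_reg (S_fun f g h \<Phi>) \<omega> (\<rho> j)) (x j w)
                         - S_reg (S_fun f g h \<Phi>) \<omega> (\<rho> j) (x j w) (y w))) w \<le> ennreal c"
  defines "v \<equiv> \<lambda>w. primal_val (\<rho> j) (x j w) - saddle_val (\<rho> j) (x j w) (y w)"
  shows "integrable M v" "expectation v \<le> c"
proof -
  have m: "v \<in> borel_measurable M"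
    unfolding v_def by (intro borel_measurable_diff measurable_primal_val measurable_saddle_val)
      (auto intro: x_in y)
  have n: "0 \<le> v w" if "w \<in> space M" for w
    using saddle_val_le_primal_val[OF x_in \<rho>_pos] y that by (simp add: v_def)
  have u: "e2ennreal (psi_P \<Lambda> (S_reg (S_fun f g h \<Phi>) \<omega> (\<rho> j)) (x j w)
      - S_reg (S_fun f g h \<Phi>) \<omega> (\<rho> j) (x j w) (y w)) = ennreal (v w)" if "w \<in> space M" for w
    using that by (simp add: v_def primal_val_ereal x_in \<rho>_pos S_reg_eq y)
  note E = expectation_le_of_nn_cond_exp[OF assms(1) m n u assms(4,5)]
  show "integrable M v" by (rule E(1))
  show "expectation v \<le> c" by (rule E(2))
qed

lemma primal_error:
  defines "v \<equiv> \<lambda>k w. saddle_val 0 (xt k w) (lhat k w) - dual_val (lhat k w)"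
  shows "integrable M (v k)" "expectation (v k) \<le> \<gamma> k"
proof -
  have m: "v k \<in> borel_measurable M"
    unfolding v_def by (intro borel_measurable_diff measurable_dual_val measurable_saddle_val)
      (auto intro: lhat_in feasible random)
  have n: "0 \<le> v k w" if "w \<in> space M" for w
    using dual_val_le[OF _ lhat_in] feasible that by (simp add: v_def)
  have u: "e2ennreal (S_fun f g h \<Phi> (xt k w) (lhat k w) - psi_D X (S_fun f g h \<Phi>) (lhat k w)) = ennreal (v k w)" if "w \<in> space M" for w
    using that by (simp add: v_def dual_val_ereal lhat_in S_fun_eq feasible)
  note E = expectation_le_of_nn_cond_exp[OF subalgebra_filt1 m n u inputs(3) step3]
  show "integrable M (v k)" by (rule E(1))
  show "expectation (v k) \<le> \<gamma> k" by (rule E(2))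
qed

definition reg_gap :: "nat \<Rightarrow> 'w \<Rightarrow> real" where
  "reg_gap k w = primal_val (\<rho> k) (x k w) - dual_val (l k w)"

lemma reg_gap_measurable: "reg_gap k \<in> borel_measurable M"
  unfolding reg_gap_def by (intro borel_measurable_diff measurable_primal_val measurable_dual_val) auto

text \<open>The next gap is squeezed between a constant, which comes from the saddle point, and the right-hand side
of \<open>one_step\<close>, which is integrable; hence integrability passes from \<open>k\<close> to \<open>Suc k\<close>.\<close>

lemma expected_step:
  assumes \<rho>: "4 * (L\<^sub>l\<^sub>l + L\<^sub>l\<^sub>x\<^sup>2 / \<mu>) * (1 - \<tau> k)\<^sup>2 \<le> \<tau> k * \<rho> k" and reg_gap: "integrable M (reg_gap k)"
  shows "integrable M (reg_gap (Suc k))"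
    "expectation (reg_gap (Suc k)) \<le> \<tau> k * expectation (reg_gap k) + \<tau> k * \<eta> k + 2 * \<gamma> k + \<eta> k"
proof -
  define a where "a = (\<lambda>w. primal_val (\<rho> k) (x k w) - saddle_val (\<rho> k) (x k w) (lt k w))"
  define b where "b = (\<lambda>w. saddle_val 0 (xt k w) (lhat k w) - dual_val (lhat k w))"
  define c where "c = (\<lambda>w. primal_val (\<rho> (Suc k)) (x (Suc k) w) - saddle_val (\<rho> (Suc k)) (x (Suc k) w) (lt' k w))"
  note A = dual_error[OF subalgebra_filt0 random(1) feasible(1) inputs(2) step1[of k], folded a_def]
  note B = primal_error[of k, folded b_def]
  note C = dual_error[OF subalgebra_filt2 random(3) feasible(3) inputs(2) step6[of k], folded c_def]
  \<comment> \<open>The right-hand side of the deterministic recursion.\<close>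
  define U where "U = (\<lambda>w. \<tau> k * reg_gap k w + \<tau> k * a w + 2 * b w + c w)"
  have U: "integrable M U" unfolding U_def using A(1) B(1) C(1) reg_gap by simp
  have upper: "reg_gap (Suc k) w \<le> U w" if w: "w \<in> space M" for w
    using one_step[OF x_in[OF w] feasible(2)[OF w] l_in[OF w] feasible(1)[OF w] feasible(3)[OF w]
        less_imp_le[OF \<tau>_bounds(1)] less_imp_le[OF \<tau>_bounds(2)] \<rho>_pos \<rho> step2 step4 step7]
    unfolding U_def a_def b_def c_def reg_gap_def step5 by linarith
  obtain ls where ls: "ls \<in> \<Lambda>" "\<And>x l. x \<in> X \<Longrightarrow> l \<in> \<Lambda> \<Longrightarrow> dual_val l \<le> saddle_val 0 x ls"
    using saddle_dual_bound by blast
  define m where "m = real_val \<omega> ls"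
  have lower: "- \<rho> (Suc k) * m \<le> reg_gap (Suc k) w" if w: "w \<in> space M" for w
    using saddle_val_le_primal_val[OF x_in[OF w, of "Suc k"] \<rho>_pos[of "Suc k"] ls(1)]
      ls(2)[OF x_in[OF w, of "Suc k"] l_in[OF w, of "Suc k"]]
      saddle_val_shift[OF x_in[OF w, of "Suc k"] ls(1), of "\<rho> (Suc k)"]
    unfolding reg_gap_def m_def by simp
  show int_G: "integrable M (reg_gap (Suc k))"
  proof (rule Bochner_Integration.integrable_bound)
    show "integrable M (\<lambda>w. \<bar>U w\<bar> + \<bar>\<rho> (Suc k) * m\<bar>)" using U by simp
    show "AE w in M. norm (reg_gap (Suc k) w) \<le> norm (\<bar>U w\<bar> + \<bar>\<rho> (Suc k) * m\<bar>)"
    proof (rule AE_I2)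
      fix w assume "w \<in> space M"
      from upper[OF this] lower[OF this]
      show "norm (reg_gap (Suc k) w) \<le> norm (\<bar>U w\<bar> + \<bar>\<rho> (Suc k) * m\<bar>)" by simp
    qed
  qed (rule reg_gap_measurable)
  have "expectation (reg_gap (Suc k)) \<le> expectation U"
    using int_G U upper by (rule integral_mono)
  also have "\<dots> = \<tau> k * expectation (reg_gap k) + \<tau> k * expectation a + 2 * expectation b + expectation c"
    unfolding U_def using A(1) B(1) C(1) reg_gap by simp
  also have "\<dots> \<le> \<tau> k * expectation (reg_gap k) + \<tau> k * \<eta> k + 2 * \<gamma> k + \<eta> k"
    using B(2) C(2) mult_left_mono[OF A(2) less_imp_le[OF \<tau>_bounds(1)[of k]]] by linarith
  finally show "expectation (reg_gap (Suc k))
    \<le> \<tau> k * expectation (reg_gap k) + \<tau> k * \<eta> k + 2 * \<gamma> k + \<eta> k" .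
qed

lemma reg_gap_0: "reg_gap 0 w = primal_val (\<rho> 0) x0 - dual_val l0"
  by (simp add: reg_gap_def start)

text \<open>Since \<open>(k+2)(k+3) \<tau>\<^sub>k = (k+1)(k+2)\<close>, the gap weighted by \<open>(k+1)(k+2)\<close> grows in step \<open>k\<close> by at most
\<open>(k+2)(k+3)\<close> times the error \<open>\<tau>\<^sub>k \<eta>\<^sub>k + 2 \<gamma>\<^sub>k + \<eta>\<^sub>k = \<epsilon> (4k+10) / (4 (k+3)\<^sup>2)\<close>. This is at most
\<open>\<epsilon> (k+2)\<close>, exactly the increment of \<open>\<epsilon>/2 (k+1)(k+2)\<close>.\<close>

lemma gap_reg_bound:
  assumes \<tau>: "\<And>k. \<tau> k = (real k + 1) / (real k + 3)" and \<epsilon>: "\<epsilon> > 0"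
    and \<gamma>: "\<And>k. \<gamma> k = \<epsilon> / (4 * (real k + 3))"
    and \<eta>: "\<And>k. \<eta> k = \<epsilon> / (4 * (real k + 3))"
    and \<rho>: "\<rho> 0 = 8 * (L\<^sub>l\<^sub>l + L\<^sub>l\<^sub>x\<^sup>2 / \<mu>)"
  shows "\<rho> k = 2 * \<rho> 0 / ((real k + 1) * (real k + 2))"
    and "integrable M (reg_gap k)"
    and "expectation (reg_gap k) \<le> 2 * (primal_val (\<rho> 0) x0 - dual_val l0) / ((real k + 1) * (real k + 2)) + \<epsilon> / 2"
proof -
  show \<rho>_formula: "\<rho> k = 2 * \<rho> 0 / ((real k + 1) * (real k + 2))" for k
  proof (induction k)
    case (Suc k)
    have "\<rho> (Suc k) = (real k + 1) / (real k + 3) * (2 * \<rho> 0 / ((real k + 1) * (real k + 2)))"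
      by (simp only: step5 \<tau> Suc)
    also have "\<dots> = 2 * \<rho> 0 / ((real k + 2) * (real k + 3))" by simp
    also have "\<dots> = 2 * \<rho> 0 / ((real (Suc k) + 1) * (real (Suc k) + 2))" by (simp add: add_ac)
    finally show ?case .
  qed simp
  define A where "A = L\<^sub>l\<^sub>l + L\<^sub>l\<^sub>x\<^sup>2 / \<mu>"
  have A: "A > 0" using inputs(1) \<rho> by (simp add: A_def)
  have cond: "4 * (L\<^sub>l\<^sub>l + L\<^sub>l\<^sub>x\<^sup>2 / \<mu>) * (1 - \<tau> k)\<^sup>2 \<le> \<tau> k * \<rho> k" for k
  proof -
    have "1 - \<tau> k = 2 / (real k + 3)" unfolding \<tau> by (simp add: field_simps)
    then have "4 * A * (1 - \<tau> k)\<^sup>2 = 16 * A / ((real k + 3) * (real k + 3))"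
      by (simp add: power2_eq_square)
    also have "\<dots> \<le> 16 * A / ((real k + 2) * (real k + 3))"
      using A by (intro divide_left_mono mult_right_mono) auto
    also have "\<dots> = \<tau> k * \<rho> k"
      unfolding \<tau> \<rho>_formula[of k] unfolding \<rho> A_def[symmetric] by simp
    finally show ?thesis unfolding A_def .
  qed
  have "integrable M (reg_gap k) \<and> (real k + 1) * (real k + 2) * expectation (reg_gap k)
      \<le> 2 * (primal_val (\<rho> 0) x0 - dual_val l0) + \<epsilon> / 2 * ((real k + 1) * (real k + 2))" for k
  proof (induction k)
    case 0
    have "reg_gap 0 = (\<lambda>_. primal_val (\<rho> 0) x0 - dual_val l0)" using reg_gap_0 by auto
    then show ?case using \<epsilon> by (simp add: prob_space)
  next
    case (Suc k)
    define E where "E = expectation (reg_gap k)"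
    \<comment> \<open>With \<open>k + 3\<close> as the variable only one denominator occurs.\<close>
    define t where "t = real k + 3"
    have t: "t \<ge> 3" "real k + 1 = t - 2" "real k + 2 = t - 1" "real k + 3 = t" by (simp_all add: t_def)
    have "expectation (reg_gap (Suc k)) \<le> \<tau> k * E + \<tau> k * \<eta> k + 2 * \<gamma> k + \<eta> k"
      unfolding E_def using expected_step(2)[OF cond] Suc by blast
    also have "\<dots> = (t - 2) / t * E + \<epsilon> * (4 * t - 2) / (4 * t * t)"
      unfolding \<tau> \<eta> \<gamma> t(2-4) using t(1) by (simp add: field_simps)
    finally have "(t - 1) * t * expectation (reg_gap (Suc k))
        \<le> (t - 1) * t * ((t - 2) / t * E + \<epsilon> * (4 * t - 2) / (4 * t * t))"
      using t(1) by (intro mult_left_mono) auto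
    also have "\<dots> = (t - 2) * (t - 1) * E + \<epsilon> * (t - 1) * ((4 * t - 2) / (4 * t))"
      using t(1) by (simp add: field_simps)
    also have "\<dots> \<le> (t - 2) * (t - 1) * E + \<epsilon> * (t - 1) * 1"
      using t(1) \<epsilon> by (intro add_left_mono mult_left_mono) auto
    also have "\<dots> \<le> 2 * (primal_val (\<rho> 0) x0 - dual_val l0) + \<epsilon> / 2 * ((t - 2) * (t - 1)) + \<epsilon> * (t - 1)"
      using Suc unfolding E_def t(2-4) by simp
    also have "\<dots> = 2 * (primal_val (\<rho> 0) x0 - dual_val l0) + \<epsilon> / 2 * ((t - 1) * t)"
      by (simp add: field_simps)
    finally have "(t - 1) * t * expectation (reg_gap (Suc k))
        \<le> 2 * (primal_val (\<rho> 0) x0 - dual_val l0) + \<epsilon> / 2 * ((t - 1) * t)" .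
    moreover have "real (Suc k) + 1 = t - 1" "real (Suc k) + 2 = t" by (simp_all add: t_def)
    ultimately show ?case
      using expected_step(1)[OF cond] Suc by (simp only: simp_thms)
  qed
  note * = this
  show "integrable M (reg_gap k)" using * by blast
  have "0 < (real k + 1) * (real k + 2)" by simp
  then have "expectation (reg_gap k) \<le> (2 * (primal_val (\<rho> 0) x0 - dual_val l0) + \<epsilon> / 2 * ((real k + 1) * (real k + 2)))
      / ((real k + 1) * (real k + 2))"
    using *[of k] by (simp add: pos_le_divide_eq mult.commute)
  also have "\<dots> = 2 * (primal_val (\<rho> 0) x0 - dual_val l0) / ((real k + 1) * (real k + 2)) + \<epsilon> / 2"
    by (simp add: add_divide_distrib)
  finally show "expectation (reg_gap k) \<le> 2 * (primal_val (\<rho> 0) x0 - dual_val l0) / ((real k + 1) * (real k + 2)) + \<epsilon> / 2" .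
qed

end

theorem theorem4p2:
  fixes X :: "'a::finite_dim_normed set" and \<Lambda> :: "'b::finite_dim_normed set"
    and f g :: "'a \<Rightarrow> ereal" and h \<omega> :: "'b \<Rightarrow> ereal" and \<Phi> :: "'a \<Rightarrow> 'b \<Rightarrow> real"
    and S :: "'a \<Rightarrow> 'b \<Rightarrow> ereal"
    and \<mu> L L\<^sub>x\<^sub>x L\<^sub>l\<^sub>x L\<^sub>l\<^sub>l L\<^sub>D \<epsilon> :: real and M :: "'w measure"
    and \<rho> \<eta> \<gamma> \<tau> :: "nat \<Rightarrow> real" and x0 :: 'a and l0 :: 'b
    and lt lt' :: "nat \<Rightarrow> 'w \<Rightarrow> 'b" and xt :: "nat \<Rightarrow> 'w \<Rightarrow> 'a"
    and x :: "nat \<Rightarrow> 'w \<Rightarrow> 'a" and l lhat :: "nat \<Rightarrow> 'w \<Rightarrow> 'b" and K :: nat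
  assumes alg: "randomized_IPDS X \<Lambda> f g h \<Phi> \<omega> \<mu> L L\<^sub>x\<^sub>x L\<^sub>l\<^sub>x L\<^sub>l\<^sub>l M \<rho> \<eta> \<gamma> \<tau> x0 l0 lt lt' xt x l lhat"
    and L\<^sub>D: "L\<^sub>D = L\<^sub>l\<^sub>l + L\<^sub>l\<^sub>x\<^sup>2 / \<mu>" "L\<^sub>D > 0"
    and \<epsilon>: "\<epsilon> > 0"
    and \<rho>: "\<rho> 0 = 8 * L\<^sub>D"
    and \<tau>: "\<And>k. \<tau> k = (real k + 1) / (real k + 3)"
    and \<gamma>: "\<And>k. \<gamma> k = \<epsilon> / (4 * (real k + 3))"
    and \<eta>: "\<And>k. \<eta> k = \<epsilon> / (4 * (real k + 3))"
    and S: "S = S_fun f g h \<Phi>"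
  shows "((\<forall>w\<in>space M. \<bar>gap_reg X \<Lambda> S \<omega> (\<rho> K) (x K w) (l K w)\<bar> \<noteq> \<infinity>) \<and>
          integrable M (\<lambda>w. real_of_ereal (gap_reg X \<Lambda> S \<omega> (\<rho> K) (x K w) (l K w))) \<and>
          (\<integral>w. real_of_ereal (gap_reg X \<Lambda> S \<omega> (\<rho> K) (x K w) (l K w)) \<partial>M)
            \<le> 2 * real_of_ereal (gap_reg X \<Lambda> S \<omega> (\<rho> 0) x0 l0) / ((real K + 1) * (real K + 2))
               + \<epsilon> / 2) \<and>
         (bounded \<Lambda> \<longrightarrow>
          (\<forall>w\<in>space M. \<bar>gap X \<Lambda> S (x K w) (l K w)\<bar> \<noteq> \<infinity>) \<and>
          integrable M (\<lambda>w. real_of_ereal (gap X \<Lambda> S (x K w) (l K w))) \<and>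
          (\<integral>w. real_of_ereal (gap X \<Lambda> S (x K w) (l K w)) \<partial>M)
            \<le> (32 * L\<^sub>D * (SUP y\<in>\<Lambda>. \<bar>real_of_ereal (\<omega> y)\<bar>) + 2 * real_of_ereal (gap X \<Lambda> S x0 l0))
                 / ((real K + 1) * (real K + 2))
               + \<epsilon> / 2)"
proof -
  interpret randomized_IPDS X \<Lambda> f g h \<Phi> \<omega> \<mu> L L\<^sub>x\<^sub>x L\<^sub>l\<^sub>x L\<^sub>l\<^sub>l M \<rho> \<eta> \<gamma> \<tau> x0 l0 lt lt' xt x l lhat
    by (rule alg)
  have \<rho>0: "\<rho> 0 = 8 * (L\<^sub>l\<^sub>l + L\<^sub>l\<^sub>x\<^sup>2 / \<mu>)" using \<rho> L\<^sub>D(1) by simp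
  note main = gap_reg_bound[OF \<tau> \<epsilon> \<gamma> \<eta> \<rho>0, of K]
  let ?n = "(real K + 1) * (real K + 2)"
  have reg: "gap_reg X \<Lambda> S \<omega> (\<rho> K) (x K w) (l K w) = ereal (reg_gap K w)" if "w \<in> space M" for w
    unfolding S reg_gap_def by (rule gap_reg_eq[OF x_in[OF that] l_in[OF that] \<rho>_pos])
  have reg0: "gap_reg X \<Lambda> S \<omega> (\<rho> 0) x0 l0 = ereal (primal_val (\<rho> 0) x0 - dual_val l0)"
    unfolding S by (rule gap_reg_eq[OF start(1,2) \<rho>_pos])
  have int_reg: "integrable M (\<lambda>w. real_of_ereal (gap_reg X \<Lambda> S \<omega> (\<rho> K) (x K w) (l K w)))"
    using main(2) by (subst Bochner_Integration.integrable_cong[where g = "reg_gap K"]) (auto simp: reg)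
  have E_reg: "(\<integral>w. real_of_ereal (gap_reg X \<Lambda> S \<omega> (\<rho> K) (x K w) (l K w)) \<partial>M) = expectation (reg_gap K)"
    by (rule Bochner_Integration.integral_cong) (auto simp: reg)
  have part1: "(\<forall>w\<in>space M. \<bar>gap_reg X \<Lambda> S \<omega> (\<rho> K) (x K w) (l K w)\<bar> \<noteq> \<infinity>) \<and>
      integrable M (\<lambda>w. real_of_ereal (gap_reg X \<Lambda> S \<omega> (\<rho> K) (x K w) (l K w))) \<and>
      (\<integral>w. real_of_ereal (gap_reg X \<Lambda> S \<omega> (\<rho> K) (x K w) (l K w)) \<partial>M)
        \<le> 2 * real_of_ereal (gap_reg X \<Lambda> S \<omega> (\<rho> 0) x0 l0) / ?n + \<epsilon> / 2"
    using int_reg main(3) unfolding E_reg reg0 by (simp add: reg)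
  have part2: "(\<forall>w\<in>space M. \<bar>gap X \<Lambda> S (x K w) (l K w)\<bar> \<noteq> \<infinity>) \<and>
      integrable M (\<lambda>w. real_of_ereal (gap X \<Lambda> S (x K w) (l K w))) \<and>
      (\<integral>w. real_of_ereal (gap X \<Lambda> S (x K w) (l K w)) \<partial>M)
        \<le> (32 * L\<^sub>D * (SUP y\<in>\<Lambda>. \<bar>real_of_ereal (\<omega> y)\<bar>) + 2 * real_of_ereal (gap X \<Lambda> S x0 l0)) / ?n + \<epsilon> / 2"
    if bd: "bounded \<Lambda>"
  proof -
    define B where "B = (SUP y\<in>\<Lambda>. \<bar>real_of_ereal (\<omega> y)\<bar>)"
    note un = unregularized_gap[OF bd, folded B_def]
    define H where "H = (\<lambda>w. primal_val 0 (x K w) - dual_val (l K w))"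
    have gap: "gap X \<Lambda> S u v = ereal (primal_val 0 u - dual_val v)" if "u \<in> X" "v \<in> \<Lambda>" for u v
      unfolding S gap_def using un(1)[OF that(1) \<rho>_pos] dual_val_ereal[OF that(2)] by simp
    have H: "gap X \<Lambda> S (x K w) (l K w) = ereal (H w)" if "w \<in> space M" for w
      unfolding H_def using gap x_in l_in that by simp
    obtain ls where ls: "ls \<in> \<Lambda>" "\<And>x l. x \<in> X \<Longrightarrow> l \<in> \<Lambda> \<Longrightarrow> dual_val l \<le> saddle_val 0 x ls"
      using saddle_dual_bound by blast
    have H_nonneg: "0 \<le> H w" if w: "w \<in> space M" for w
      using un(2)[OF x_in[OF w] \<rho>_pos ls(1)] ls(2)[OF x_in[OF w] l_in[OF w]]
      unfolding H_def by (meson diff_ge_0_iff_ge order_trans)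
    have H_le: "H w \<le> reg_gap K w + \<rho> K * B" if w: "w \<in> space M" for w
      using un(3)[OF x_in[OF w] \<rho>_pos, of K K] unfolding H_def reg_gap_def by simp
    have int_H: "integrable M H"
    proof (rule Bochner_Integration.integrable_bound)
      show "integrable M (\<lambda>w. reg_gap K w + \<rho> K * B)" using main(2) by simp
      show "H \<in> borel_measurable M"
        unfolding H_def by (intro borel_measurable_diff measurable_primal_val measurable_dual_val) auto
      show "AE w in M. norm (H w) \<le> norm (reg_gap K w + \<rho> K * B)"
      proof (rule AE_I2)
        fix w assume "w \<in> space M"
        from H_nonneg[OF this] H_le[OF this] show "norm (H w) \<le> norm (reg_gap K w + \<rho> K * B)" by simp
      qed
    qed
    have int_gap: "integrable M (\<lambda>w. real_of_ereal (gap X \<Lambda> S (x K w) (l K w)))"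
      using int_H by (subst Bochner_Integration.integrable_cong[where g = H]) (auto simp: H)
    have "(\<integral>w. real_of_ereal (gap X \<Lambda> S (x K w) (l K w)) \<partial>M) = expectation H"
      by (rule Bochner_Integration.integral_cong) (auto simp: H)
    also have "\<dots> \<le> expectation (\<lambda>w. reg_gap K w + \<rho> K * B)"
      using main(2) by (intro integral_mono int_H H_le) simp_all
    also have "\<dots> = expectation (reg_gap K) + \<rho> K * B" using main(2) by (simp add: prob_space)
    also have "\<dots> \<le> 2 * (primal_val (\<rho> 0) x0 - dual_val l0) / ?n + \<epsilon> / 2 + 2 * \<rho> 0 / ?n * B"
      using main(3) main(1) by simp
    also have "\<dots> \<le> 2 * (primal_val 0 x0 + \<rho> 0 * B - dual_val l0) / ?n + \<epsilon> / 2 + 2 * \<rho> 0 / ?n * B"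
      using un(4)[OF start(1) \<rho>_pos[of 0]] by (intro add_right_mono divide_right_mono) auto
    also have "\<dots> = (32 * L\<^sub>D * B + 2 * (primal_val 0 x0 - dual_val l0)) / ?n + \<epsilon> / 2"
    proof -
      have "32 * L\<^sub>D * B + 2 * (primal_val 0 x0 - dual_val l0) = 2 * (primal_val 0 x0 + \<rho> 0 * B - dual_val l0) + 2 * \<rho> 0 * B"
        unfolding \<rho> by (simp add: algebra_simps)
      moreover have "u / n + e + v / n * b = (u + v * b) / n + e" for u v n e b :: real
        by (simp add: add_divide_distrib)
      ultimately show ?thesis by (simp only:)
    qed
    finally show ?thesis
      using int_gap gap[OF start(1,2)] by (simp add: H B_def)
  qed
  show ?thesis by (rule conjI[OF part1 impI[OF part2]])
qed

end
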